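(* Let $N > 0$ and $0 \leqslant n_0 < \dots < n_{N-1}$ be integers, and for each integer $M > n_{N-1}$, let $\epsilon_M \in \{-1,0,+1\}$ be a sign. Suppose that whenever $\epsilon_{M_0} = -1$ for some $M_0 > n_{N-1}$, one has $\epsilon_M = +1$ for at least $N$ choices of $M > M_0$. Let $c_{n_0},\dots,c_{n_{N-1}}$ be positive reals. Then there exists a convergent power series $$f(x) = c_{n_0} x^{n_0} + c_{n_1} x^{n_1} + \dots + c_{n_{N-1}} x^{n_{N-1}} + \sum_{M > n_{N-1}} c_M x^M$$ on $(0,+\infty)$ (with real coefficients) that preserves total non-negativity on $\mathrm{HTN}_N((0,+\infty))$ when applied entrywise, such that for each integer $M > n_{N-1}$, $c_M$ has the sign of $\epsilon_M$ (negative, zero, or positive according as $\epsilon_M=-1,0,+1$).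
   Context: A real matrix is totally non-negative if all its minors are non-negative. For $I \subset [0,+\infty)$, $\mathrm{HTN}_N(I)$ is the set of $N\times N$ Hankel totally non-negative matrices with entries in $I$. A function $f$ preserves total non-negativity on $\mathrm{HTN}_N(I)$ when applied entrywise if $f[A] := (f(a_{jk}))$ is totally non-negative for every $A=(a_{jk}) \in \mathrm{HTN}_N(I)$. *)

theory Defs
  imports
    "HOL-Analysis.Analysis"
    "Jordan_Normal_Form.Determinant"
    "Jordan_Normal_Form.DL_Submatrix"
begin

text \<open>The minors of \<open>A\<close> are the determinants of the submatrices of \<open>A\<close> with row set \<open>I\<close> and
  column set \<open>J\<close> of the same size. The empty minor is \<open>1\<close>, so admitting it imposes nothing.\<close>

definition totally_nonneg :: "real mat \<Rightarrow> bool" where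
  "totally_nonneg A \<longleftrightarrow>
     (\<forall>I J. I \<subseteq> {..<dim_row A} \<longrightarrow> J \<subseteq> {..<dim_col A} \<longrightarrow> card I = card J \<longrightarrow>
        0 \<le> Determinant.det (submatrix A I J))"

definition hankel :: "'a mat \<Rightarrow> bool" where
  "hankel A \<longleftrightarrow> (\<exists>s. \<forall>i<dim_row A. \<forall>j<dim_col A. A $$ (i, j) = s (i + j))"

definition HTN :: "nat \<Rightarrow> real set \<Rightarrow> real mat set" where
  "HTN N S = {A \<in> carrier_mat N N. hankel A \<and> totally_nonneg A \<and> elements_mat A \<subseteq> S}"

definition entrywise_preserves_TN_on :: "(real \<Rightarrow> real) \<Rightarrow> real mat set \<Rightarrow> bool" where
  "entrywise_preserves_TN_on f \<A> \<longleftrightarrow> (\<forall>A\<in>\<A>. totally_nonneg (map_mat f A))"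

end

theory Submission
  imports Defs
begin

text \<open>
  A Hankel matrix \<open>s (i + j)\<close> of size \<open>N\<close> is totally non-negative exactly when it and its shift
  \<open>s (i + j + 1)\<close> of size \<open>N - 1\<close> are positive semidefinite. So total non-negativity of Hankel matrices,
  unlike that of general matrices, is a convex condition, and the theorem reduces to a statement on
  quadratic forms: the series has to map positive semidefinite matrices of size at most \<open>N\<close> with
  positive entries to positive semidefinite matrices (\<open>entrywise_preserves_HTN\<close>).

  Write \<open>Q t\<close> for the quadratic form of the entrywise power \<open>a i j ^ t\<close>, which is non-negative by the
  Schur product theorem. The heart of the matter is that a power with \<open>N\<close> lower exponents \<open>L\<close> and \<open>N\<close>
  higher exponents \<open>S\<close> satisfies \<open>Q M \<le> K * (\<Sum>t\<in>L \<union> S. Q t)\<close> with \<open>K\<close> depending on the exponents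
  only (\<open>psd_power_domination\<close>). Granted this, take the positive coefficients to be \<open>c\<close> and
  \<open>1 / fact M\<close>. A negative coefficient may be chosen so small that its term is at most
  \<open>(1/2) ^ Suc M\<close> times the sum \<open>F\<close> of all positive terms; the negative terms together then take away
  at most \<open>F\<close>, and this on every matrix at once.

  For rank one, \<open>a i j = u i * u j\<close>, the domination follows once \<open>x ^ M\<close> can be interpolated at any
  \<open>N\<close> points of the positive half line by a combination of powers from \<open>L \<union> S\<close> with coefficients
  bounded independently of the points.
  If \<open>k\<close> of the points lie in \<open>(0, 1]\<close>, use \<open>k\<close> exponents from \<open>L\<close> and \<open>N - k\<close> from \<open>S\<close>. The difference
  is then a polynomial with \<open>N + 1\<close> terms and \<open>N\<close> positive roots whose exponent \<open>M\<close> has as many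
  exponents below it as there are roots up to \<open>1\<close>; for such a polynomial the coefficient of \<open>x ^ M\<close>
  dominates all others (\<open>coefficient_domination\<close>, by induction with Rolle's theorem). From rank one to
  arbitrary rank one passes with the extension principle of FitzGerald and Horn
  (\<open>preserves_psd_extension\<close>): subtract the rank one matrix that agrees with \<open>a\<close> in the first row, and
  follow the segment between the two; the derivative reduces to size \<open>N - 1\<close>.

  For the criterion on Hankel matrices, one direction is that a symmetric matrix with non-negative
  principal minors is positive semidefinite. In the other direction, contiguous minors of a Hankel
  matrix are principal minors of the matrix or of its shift, and by Fekete's criterion (\<open>fekete\<close>) it
  suffices that these are positive; a small positive definite Hankel perturbation makes them so.
\<close>

section \<open>Quadratic forms and the Schur product theorem\<close>

definition qform :: "nat \<Rightarrow> (nat \<Rightarrow> nat \<Rightarrow> real) \<Rightarrow> (nat \<Rightarrow> real) \<Rightarrow> real" where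
  "qform m a v = (\<Sum>i<m. \<Sum>j<m. v i * v j * a i j)"

definition psd :: "nat \<Rightarrow> (nat \<Rightarrow> nat \<Rightarrow> real) \<Rightarrow> bool" where
  "psd m a \<longleftrightarrow> (\<forall>i<m. \<forall>j<m. a i j = a j i) \<and> (\<forall>v. 0 \<le> qform m a v)"

text \<open>
  The Schur complement of the entry at \<open>(0, 0)\<close>, renumbered to start at \<open>0\<close> as
  inductions on the size of the matrix need it.
\<close>

definition schur :: "(nat \<Rightarrow> nat \<Rightarrow> real) \<Rightarrow> nat \<Rightarrow> nat \<Rightarrow> real" where
  "schur a i j = a (Suc i) (Suc j) - a (Suc i) 0 * a 0 (Suc j) / a 0 0"

lemma qform_cong:
  assumes "\<And>i j. i < m \<Longrightarrow> j < m \<Longrightarrow> a i j = b i j" "\<And>i. i < m \<Longrightarrow> v i = w i"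
  shows "qform m a v = qform m b w"
  using assms by (auto simp: qform_def intro!: sum.cong)

lemma psd_sym: "psd m a \<Longrightarrow> i < m \<Longrightarrow> j < m \<Longrightarrow> a i j = a j i"
  by (auto simp: psd_def)

lemma psd_qform: "psd m a \<Longrightarrow> 0 \<le> qform m a v"
  by (auto simp: psd_def)

lemma qform_add: "qform m (\<lambda>i j. a i j + b i j) v = qform m a v + qform m b v"
  by (simp add: qform_def algebra_simps sum.distrib)

lemma qform_diff: "qform m (\<lambda>i j. a i j - b i j) v = qform m a v - qform m b v"
  by (simp add: qform_def algebra_simps sum_subtractf)

lemma qform_scale: "qform m (\<lambda>i j. c * a i j) v = c * qform m a v"
  by (simp add: qform_def algebra_simps sum_distrib_left)

lemma qform_sum: "qform m (\<lambda>i j. \<Sum>t\<in>T. f t i j) v = (\<Sum>t\<in>T. qform m (f t) v)"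
proof (induction T rule: infinite_finite_induct)
  case (insert x F)
  then show ?case by (simp add: qform_add)
qed (simp_all add: qform_def)

lemma qform_rank_one: "qform m (\<lambda>i j. u i * u j) v = (\<Sum>i<m. v i * u i)\<^sup>2"
  by (simp add: qform_def power2_eq_square sum_product algebra_simps)

lemma qform_zero [simp]: "qform m a (\<lambda>_. 0) = 0"
  by (simp add: qform_def)

lemma qform_Suc:
  "qform (Suc m) a v = v 0 * v 0 * a 0 0 + v 0 * (\<Sum>j<m. v (Suc j) * a 0 (Suc j))
     + v 0 * (\<Sum>i<m. v (Suc i) * a (Suc i) 0)
     + qform m (\<lambda>i j. a (Suc i) (Suc j)) (\<lambda>i. v (Suc i))"
  unfolding qform_def
  by (simp only: sum.lessThan_Suc_shift sum.distrib sum_distrib_left) (simp add: algebra_simps)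

text \<open>
  Completing the square in the variable \<open>v 0\<close>.
\<close>

lemma qform_schur:
  assumes "a 0 0 \<noteq> 0" "\<And>j. j < m \<Longrightarrow> a 0 (Suc j) = a (Suc j) 0"
  shows "qform (Suc m) a v
    = a 0 0 * (v 0 + (\<Sum>i<m. v (Suc i) * a (Suc i) 0) / a 0 0)\<^sup>2 + qform m (schur a) (\<lambda>i. v (Suc i))"
proof -
  let ?S = "\<Sum>i<m. v (Suc i) * a (Suc i) 0"
  have S: "(\<Sum>j<m. v (Suc j) * a 0 (Suc j)) = ?S"
    using assms(2) by (intro sum.cong) auto
  have "qform m (schur a) (\<lambda>i. v (Suc i))
      = qform m (\<lambda>i j. a (Suc i) (Suc j) - (1 / a 0 0) * (a (Suc i) 0 * a (Suc j) 0)) (\<lambda>i. v (Suc i))"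
    using assms(2) by (intro qform_cong) (auto simp: schur_def)
  also have "\<dots> = qform m (\<lambda>i j. a (Suc i) (Suc j)) (\<lambda>i. v (Suc i)) - (1 / a 0 0) * ?S\<^sup>2"
    by (simp only: qform_diff qform_scale qform_rank_one)
  finally have Q: "qform m (\<lambda>i j. a (Suc i) (Suc j)) (\<lambda>i. v (Suc i))
      = qform m (schur a) (\<lambda>i. v (Suc i)) + (1 / a 0 0) * ?S\<^sup>2"
    by simp
  show ?thesis
    unfolding qform_Suc S Q using assms(1) by (simp add: field_simps power2_eq_square)
qed

text \<open>
  Choose the variable \<open>v 0\<close> so that the square in \<open>qform_schur\<close> vanishes.
\<close>

lemma psd_schur:
  assumes "psd (Suc m) a" "0 < a 0 0"
  shows "psd m (schur a)"
  unfolding psd_def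
proof (intro conjI allI impI)
  have sym: "\<And>j. j < m \<Longrightarrow> a 0 (Suc j) = a (Suc j) 0"
    using assms(1) psd_sym[of "Suc m" a 0] by auto
  show "schur a i j = schur a j i" if "i < m" "j < m" for i j
    using that sym psd_sym[OF assms(1), of "Suc i" "Suc j"] by (simp add: schur_def)
  fix v
  let ?w = "case_nat (- (\<Sum>i<m. v i * a (Suc i) 0) / a 0 0) v"
  have "0 \<le> qform (Suc m) a ?w" using assms(1) by (rule psd_qform)
  then show "0 \<le> qform m (schur a) v"
    using assms(2) by (subst (asm) qform_schur) (auto simp: sym)
qed

lemma psd_shift:
  assumes "psd (Suc m) a"
  shows "psd m (\<lambda>i j. a (Suc i) (Suc j))"
  unfolding psd_def
proof (intro conjI allI impI)
  fix v
  show "0 \<le> qform m (\<lambda>i j. a (Suc i) (Suc j)) v"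
    using psd_qform[OF assms, of "case_nat 0 v"] by (simp add: qform_Suc)
qed (use psd_sym[OF assms] in auto)

lemma psd_diag: assumes "psd (Suc m) a" shows "0 \<le> a 0 0"
  using psd_qform[OF assms, of "case_nat 1 (\<lambda>_. 0)"] by (simp add: qform_Suc)

text \<open>
  With a zero at \<open>(0, 0)\<close> the form is affine in \<open>v 0\<close>, so it can only be bounded below if the slope
  vanishes. This is the case in which no Schur complement exists.
\<close>

lemma psd_zero_row:
  assumes "psd (Suc m) a" "a 0 0 = 0" "j < m"
  shows "a 0 (Suc j) = 0"
proof (rule ccontr)
  let ?b = "a 0 (Suc j)" and ?d = "a (Suc j) (Suc j)"
  assume b: "?b \<noteq> 0"
  have sym: "a (Suc j) 0 = ?b" using psd_sym[OF assms(1)] assms(3) by auto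
  have "0 \<le> 2 * x * ?b + ?d" for x
  proof -
    have "qform m (\<lambda>i j. a (Suc i) (Suc j)) (\<lambda>i. if i = j then 1 else 0) = ?d"
    proof -
      have "(\<Sum>k<m. (if i = j then 1 else 0) * (if k = j then 1 else 0) * a (Suc i) (Suc k))
          = (if i = j then a (Suc j) (Suc j) else 0)" if "i < m" for i
        using assms(3) by (simp add: if_distrib[of "\<lambda>t. t * _"] cong: if_cong)
      then show ?thesis using assms(3) by (simp add: qform_def)
    qed
    with psd_qform[OF assms(1), of "case_nat x (\<lambda>i. if i = j then 1 else 0)"] assms(2,3) sym
    show ?thesis
      by (simp add: qform_Suc if_distrib[of "\<lambda>t. t * _"] cong: if_cong)
  qed
  from this[of "(- ?d - 1) / (2 * ?b)"] b show False by (simp add: field_simps)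
qed

lemma qform_zero_border:
  assumes "\<And>j. j \<le> m \<Longrightarrow> d 0 j = 0" "\<And>i. i \<le> m \<Longrightarrow> d i 0 = 0"
  shows "qform (Suc m) d v = qform m (\<lambda>i j. d (Suc i) (Suc j)) (\<lambda>i. v (Suc i))"
  using assms by (simp add: qform_Suc)

text \<open>
  Split \<open>a\<close> into the rank one matrix \<open>a i 0 * a 0 j / a 0 0\<close> and its Schur complement. The rank one part
  acts on \<open>b\<close> by rescaling the variables; the rest lives on the indices from \<open>1\<close> on, where induction applies.
\<close>

lemma psd_schur_product:
  assumes "psd m a" "psd m b"
  shows "psd m (\<lambda>i j. a i j * b i j)"
  using assms
proof (induction m arbitrary: a b)
  case 0
  then show ?case by (simp add: psd_def qform_def)
next
  case (Suc m)
  have sym: "a i j = a j i" "b i j = b j i" if "i \<le> m" "j \<le> m" for i j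
    using that Suc.prems psd_sym[of "Suc m"] by auto
  have nn: "0 \<le> qform (Suc m) (\<lambda>i j. a i j * b i j) v" for v
  proof (cases "a 0 0 = 0")
    case True
    have z: "a 0 j = 0" if "j \<le> m" for j
      using psd_zero_row[OF Suc.prems(1) True, of "j - 1"] True that by (cases j) auto
    have "qform (Suc m) (\<lambda>i j. a i j * b i j) v
        = qform m (\<lambda>i j. a (Suc i) (Suc j) * b (Suc i) (Suc j)) (\<lambda>i. v (Suc i))"
      using z sym(1)[of _ 0] by (intro qform_zero_border) auto
    also have "0 \<le> \<dots>"
      by (intro psd_qform Suc.IH psd_shift Suc.prems)
    finally show ?thesis .
  next
    case False
    with psd_diag[OF Suc.prems(1)] have pos: "0 < a 0 0" by simp
    let ?d = "\<lambda>i j. a i j - a i 0 * a 0 j / a 0 0"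
    have "qform (Suc m) (\<lambda>i j. a i j * b i j) v
        = qform (Suc m) (\<lambda>i j. ?d i j * b i j + (1 / a 0 0) * ((a i 0 * a j 0) * b i j)) v"
    proof (intro qform_cong refl)
      fix i j assume "i < Suc m" "j < Suc m"
      then have "a 0 j = a j 0" using sym(1)[of 0 j] by simp
      then show "a i j * b i j = ?d i j * b i j + (1 / a 0 0) * ((a i 0 * a j 0) * b i j)"
        by (simp add: algebra_simps)
    qed
    also have "\<dots> = qform (Suc m) (\<lambda>i j. ?d i j * b i j) v
        + (1 / a 0 0) * qform (Suc m) (\<lambda>i j. (a i 0 * a j 0) * b i j) v"
      by (simp only: qform_add qform_scale)
    also have "qform (Suc m) (\<lambda>i j. (a i 0 * a j 0) * b i j) v = qform (Suc m) b (\<lambda>i. v i * a i 0)"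
      by (simp add: qform_def algebra_simps)
    also have "qform (Suc m) (\<lambda>i j. ?d i j * b i j) v
        = qform m (\<lambda>i j. schur a i j * b (Suc i) (Suc j)) (\<lambda>i. v (Suc i))"
      using pos by (subst qform_zero_border) (auto simp: schur_def)
    finally show ?thesis
      using pos psd_qform[OF Suc.prems(2)]
        psd_qform[OF Suc.IH[OF psd_schur[OF Suc.prems(1) pos] psd_shift[OF Suc.prems(2)]]]
      by simp
  qed
  show ?case
    using sym by (simp add: psd_def nn)
qed

lemma psd_power: "psd m a \<Longrightarrow> psd m (\<lambda>i j. a i j ^ t)"
proof (induction t)
  case 0
  show ?case using qform_rank_one[of m "\<lambda>_. 1"] by (simp add: psd_def)
next
  case (Suc t)
  then show ?case using psd_schur_product[of m a] by simp
qed

section \<open>From rank one to positive semidefinite matrices\<close>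

text \<open>
  The extension principle of FitzGerald and Horn. The rank one matrix
  \<open>B i j = a i 0 * a 0 j / a 0 0\<close> agrees with \<open>a\<close> in row and column \<open>0\<close>, so along the segment from \<open>B\<close> to \<open>a\<close>
  the derivative of the quadratic form is the form of the entrywise product of the Schur complement with
  values of \<open>P'\<close>, and involves only the remaining \<open>m\<close> indices. The Schur product theorem makes it
  non-negative, so the form at \<open>a\<close> is at least the form at \<open>B\<close>.
\<close>

lemma preserves_psd_extension:
  fixes P P' :: "real \<Rightarrow> real"
  assumes a: "psd (Suc m) a" and pos: "\<And>i j. i \<le> m \<Longrightarrow> j \<le> m \<Longrightarrow> 0 < a i j"
    and deriv: "\<And>x. 0 < x \<Longrightarrow> (P has_real_derivative P' x) (at x)"
    and rank_one: "\<And>u. (\<And>i. i \<le> m \<Longrightarrow> 0 < u i) \<Longrightarrow> 0 \<le> qform (Suc m) (\<lambda>i j. P (u i * u j)) v"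
    and smaller: "\<And>b w. psd m b \<Longrightarrow> (\<And>i j. i < m \<Longrightarrow> j < m \<Longrightarrow> 0 < b i j) \<Longrightarrow>
                    0 \<le> qform m (\<lambda>i j. P' (b i j)) w"
  shows "0 \<le> qform (Suc m) (\<lambda>i j. P (a i j)) v"
proof -
  define B where "B i j = a i 0 * a 0 j / a 0 0" for i j
  define X where "X l i j = B i j + l * (a i j - B i j)" for l i j
  define g where "g l = qform (Suc m) (\<lambda>i j. P (X l i j)) v" for l
  have sym: "a i j = a j i" if "i \<le> m" "j \<le> m" for i j
    using that a psd_sym[of "Suc m"] by auto
  have sym0': "a 0 j = a j 0" if "j < Suc m" for j using sym that by simp
  have sym0: "a 0 (Suc j) = a (Suc j) 0" if "j < m" for j using sym that by simp
  have a00: "0 < a 0 0" using pos by simp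
  have Bpos: "0 < B i j" if "i \<le> m" "j \<le> m" for i j
    using pos that by (simp add: B_def)
  have Xpos: "0 < X l i j" if "i \<le> m" "j \<le> m" "0 \<le> l" "l \<le> 1" for l i j
  proof (cases "l = 0")
    case True
    then show ?thesis using Bpos that by (simp add: X_def)
  next
    case False
    have "X l i j = (1 - l) * B i j + l * a i j" by (simp add: X_def algebra_simps)
    also have "\<dots> > 0"
      using False that Bpos[of i j] pos[of i j] by (intro add_nonneg_pos) auto
    finally show ?thesis .
  qed
  have Bsym: "B i j = B j i" if "i \<le> m" "j \<le> m" for i j
    using sym[of 0 i] sym[of 0 j] that by (simp add: B_def)
  have Xpsd: "psd m (\<lambda>i j. X l (Suc i) (Suc j))" if "0 \<le> l" "l \<le> 1" for l
    unfolding psd_def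
  proof (intro conjI allI impI)
    show "X l (Suc i) (Suc j) = X l (Suc j) (Suc i)" if "i < m" "j < m" for i j
      using that Bsym[of "Suc i" "Suc j"] sym[of "Suc i" "Suc j"] by (simp add: X_def)
    fix w
    have "qform m (\<lambda>i j. X l (Suc i) (Suc j)) w
        = qform m (\<lambda>i j. (1 / a 0 0) * (a (Suc i) 0 * a (Suc j) 0) + l * schur a i j) w"
      using sym0 by (intro qform_cong) (auto simp: X_def B_def schur_def)
    also have "\<dots> = (1 / a 0 0) * (\<Sum>i<m. w i * a (Suc i) 0)\<^sup>2 + l * qform m (schur a) w"
      by (simp only: qform_add qform_scale qform_rank_one)
    also have "\<dots> \<ge> 0"
      using a00 that psd_qform[OF psd_schur[OF a a00]] by simp
    finally show "0 \<le> qform m (\<lambda>i j. X l (Suc i) (Suc j)) w" .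
  qed
  have der: "(g has_real_derivative qform (Suc m) (\<lambda>i j. (a i j - B i j) * P' (X l i j)) v) (at l)"
    if "0 \<le> l" "l \<le> 1" for l
  proof -
    have "((\<lambda>l. v i * v j * P (X l i j)) has_real_derivative
            v i * v j * ((a i j - B i j) * P' (X l i j))) (at l)" if ij: "i < Suc m" "j < Suc m" for i j
    proof -
      have dX: "((\<lambda>l. X l i j) has_real_derivative (a i j - B i j)) (at l)"
        unfolding X_def by (auto intro!: derivative_eq_intros)
      have "0 < X l i j" using Xpos ij that \<open>0 \<le> l\<close> \<open>l \<le> 1\<close> by auto
      from DERIV_chain2[OF deriv[OF this] dX]
      have "((\<lambda>l. P (X l i j)) has_real_derivative (P' (X l i j) * (a i j - B i j))) (at l)" .
      from DERIV_cmult[OF this, of "v i * v j"] show ?thesis by (simp add: mult.commute)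
    qed
    then show ?thesis
      unfolding g_def qform_def by (intro DERIV_sum) auto
  qed
  have "g 0 \<le> g 1"
  proof (rule DERIV_nonneg_imp_nondecreasing[where f = g and a = 0 and b = 1])
    fix l :: real assume l: "0 \<le> l" "l \<le> 1"
    have "qform (Suc m) (\<lambda>i j. (a i j - B i j) * P' (X l i j)) v
        = qform m (\<lambda>i j. schur a i j * P' (X l (Suc i) (Suc j))) (\<lambda>i. v (Suc i))"
      using a00 by (subst qform_zero_border) (auto simp: B_def schur_def)
    moreover have "psd m (\<lambda>i j. P' (X l (Suc i) (Suc j)))"
      unfolding psd_def
    proof (intro conjI allI impI)
      show "P' (X l (Suc i) (Suc j)) = P' (X l (Suc j) (Suc i))" if "i < m" "j < m" for i j
        using psd_sym[OF Xpsd[OF l] that] by simp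
      show "0 \<le> qform m (\<lambda>i j. P' (X l (Suc i) (Suc j))) w" for w
        using Xpos l by (intro smaller[OF Xpsd[OF l]]) auto
    qed
    ultimately have "0 \<le> qform (Suc m) (\<lambda>i j. (a i j - B i j) * P' (X l i j)) v"
      using psd_qform[OF psd_schur_product[OF psd_schur[OF a a00]]] by simp
    with der[OF l] show "\<exists>y. (g has_real_derivative y) (at l) \<and> 0 \<le> y" by blast
  qed simp
  moreover have "g 0 = qform (Suc m) (\<lambda>i j. P ((a i 0 / sqrt (a 0 0)) * (a j 0 / sqrt (a 0 0)))) v"
    unfolding g_def
  proof (intro qform_cong refl)
    fix i j assume "i < Suc m" "j < Suc m"
    have "B i j = a i 0 * a j 0 / (sqrt (a 0 0) * sqrt (a 0 0))"
      using a00 sym0'[OF \<open>j < Suc m\<close>] by (simp add: B_def)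
    then show "P (X 0 i j) = P (a i 0 / sqrt (a 0 0) * (a j 0 / sqrt (a 0 0)))"
      by (simp only: X_def mult_zero_left add_0_right times_divide_times_eq)
  qed
  moreover have "0 \<le> \<dots>"
    using pos by (intro rank_one) auto
  moreover have "g 1 = qform (Suc m) (\<lambda>i j. P (a i j)) v"
    by (simp add: g_def X_def)
  ultimately show ?thesis by simp
qed

section \<open>Coefficients of sparse polynomials with many positive roots\<close>

lemma rolle_count:
  fixes f f' :: "real \<Rightarrow> real"
  assumes "finite Z" "Z \<subseteq> {0<..}" "\<And>x. x \<in> Z \<Longrightarrow> f x = 0"
    and der: "\<And>x. 0 < x \<Longrightarrow> (f has_real_derivative f' x) (at x)"
  shows "\<exists>Z'. finite Z' \<and> card Z' = card Z - 1 \<and>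
           (\<forall>z\<in>Z'. f' z = 0 \<and> (\<exists>x\<in>Z. \<exists>y\<in>Z. x < z \<and> z < y))"
  using assms(1-3)
proof (induction Z rule: finite_linorder_max_induct)
  case empty
  then show ?case by auto
next
  case (insert b A)
  show ?case
  proof (cases "A = {}")
    case True
    then show ?thesis by (intro exI[of _ "{}"]) simp
  next
    case False
    obtain Z' where Z': "finite Z'" "card Z' = card A - 1"
        "\<And>z. z \<in> Z' \<Longrightarrow> f' z = 0 \<and> (\<exists>x\<in>A. \<exists>y\<in>A. x < z \<and> z < y)"
      using insert by auto
    let ?m = "Max A"
    have m: "?m \<in> A" using False insert.hyps by simp
    then have mb: "0 < ?m" "?m < b" using insert by auto
    have "\<exists>z>?m. z < b \<and> f' z = 0"
    proof -
      have "\<exists>z>?m. z < b \<and> (\<lambda>v. f' z * v) = (\<lambda>v. 0)"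
      proof (rule Rolle_deriv[where f = f and f' = "\<lambda>x v. f' x * v", OF mb(2)])
        show "f ?m = f b" using insert.prems m by simp
        show "continuous_on {?m..b} f"
          using mb by (auto intro!: continuous_at_imp_continuous_on DERIV_isCont[OF der])
        show "(f has_derivative (\<lambda>v. f' x * v)) (at x)" if "?m < x" "x < b" for x
          using der[of x] that mb by (simp add: has_field_derivative_def)
      qed
      then show ?thesis by (metis mult.right_neutral)
    qed
    then obtain z where z: "?m < z" "z < b" "f' z = 0" by blast
    have new: "z \<notin> Z'"
      using Z'(3)[of z] z(1) insert.hyps Max_ge[of A] by fastforce
    show ?thesis
    proof (intro exI[of _ "insert z Z'"] conjI ballI)
      have "card A > 0" using False insert.hyps by (simp add: card_gt_0_iff)
      then show "card (insert z Z') = card (insert b A) - 1"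
        using Z' new insert.hyps by auto
    qed (use Z' z m in auto)
  qed
qed

text \<open>
  Starting from \<open>a\<close>, the function moves away from \<open>0\<close>, yet it has to return to \<open>0\<close> at \<open>b\<close>.
\<close>

lemma derivative_zero_to_the_right:
  fixes f f' :: "real \<Rightarrow> real"
  assumes ab: "a < b" and "f b = 0" and sgn: "0 < f a * f' a"
    and der: "\<And>x. a \<le> x \<Longrightarrow> x \<le> b \<Longrightarrow> (f has_real_derivative f' x) (at x)"
    and cont: "continuous_on {a..b} f'"
  shows "\<exists>z. a < z \<and> z < b \<and> f' z = 0"
proof -
  obtain z1 where z1: "a < z1" "z1 < b" "f b - f a = (b - a) * f' z1"
    using MVT2[OF ab, of f f'] der by blast
  then have neg: "f a * f' z1 < 0"
  proof -
    have "f a * ((b - a) * f' z1) = - (f a)\<^sup>2"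
      using z1(3) \<open>f b = 0\<close> by (simp add: power2_eq_square flip: z1(3))
    moreover have "- (f a)\<^sup>2 < 0" using sgn by auto
    ultimately have "(b - a) * (f a * f' z1) < 0" by (simp only: mult.left_commute)
    then show ?thesis using ab by (simp add: mult_less_0_iff)
  qed
  have "\<exists>z\<ge>a. z \<le> z1 \<and> f a * f' z = 0"
    using z1 neg sgn
    by (intro IVT2'[of "\<lambda>x. f a * f' x"])
       (auto intro!: continuous_intros continuous_on_subset[OF cont])
  then obtain z where z: "a \<le> z" "z \<le> z1" "f a * f' z = 0" by blast
  with sgn have "z \<noteq> a" "f' z = 0" by auto
  with z z1 show ?thesis by (intro exI[of _ z]) auto
qed

lemma derivative_zero_to_the_left:
  fixes f f' :: "real \<Rightarrow> real"
  assumes ab: "a < b" and "f a = 0" and sgn: "f b * f' b < 0"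
    and der: "\<And>x. a \<le> x \<Longrightarrow> x \<le> b \<Longrightarrow> (f has_real_derivative f' x) (at x)"
    and cont: "continuous_on {a..b} f'"
  shows "\<exists>z. a < z \<and> z < b \<and> f' z = 0"
proof -
  have "\<exists>z. -b < z \<and> z < -a \<and> - f' (- z) = 0"
  proof (rule derivative_zero_to_the_right[where f = "\<lambda>x. f (- x)"])
    show "((\<lambda>x. f (- x)) has_real_derivative - f' (- x)) (at x)" if "- b \<le> x" "x \<le> - a" for x
    proof -
      have "(f has_real_derivative f' (- x)) (at (- x))" using der[of "-x"] that by auto
      moreover have "((\<lambda>x::real. - x) has_real_derivative -1) (at x)"
        by (auto intro!: derivative_eq_intros)
      ultimately show ?thesis using DERIV_chain2[of f "f' (- x)" uminus x "-1" UNIV] by simp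
    qed
    show "continuous_on {- b..- a} (\<lambda>x. - f' (- x))"
      by (intro continuous_intros continuous_on_compose2[OF cont]) auto
  qed (use assms in auto)
  then obtain z where "-b < z" "z < -a" "f' (- z) = 0" by auto
  then show ?thesis by (intro exI[of _ "- z"]) auto
qed

abbreviation sparse_poly :: "nat set \<Rightarrow> (nat \<Rightarrow> real) \<Rightarrow> real \<Rightarrow> real" where
  "sparse_poly T g x \<equiv> (\<Sum>t\<in>T. g t * x ^ t)"

text \<open>
  The coefficients that the operator \<open>x * d/dx - m\<close> produces. It removes the exponent \<open>m\<close> and keeps all
  other exponents in place, so no renumbering of exponents is needed in inductions.
\<close>

abbreviation euler_shift :: "nat \<Rightarrow> (nat \<Rightarrow> real) \<Rightarrow> nat \<Rightarrow> real" where
  "euler_shift m g t \<equiv> (real t - real m) * g t"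

text \<open>
  On the positive half line, the zeros of the derivative of \<open>q / x ^ m\<close> are those of \<open>x * q' - m * q\<close>. This
  is how Rolle's theorem yields zeros of a polynomial with one exponent less, for an exponent of choice.
\<close>

lemma sparse_poly_quotient_deriv:
  assumes "0 < x"
  shows "((\<lambda>x. sparse_poly T g x / x ^ m) has_real_derivative
           sparse_poly T (euler_shift m g) x / x ^ Suc m) (at x)"
proof -
  have "((\<lambda>x. \<Sum>t\<in>T. g t * x ^ t / x ^ m) has_real_derivative
           (\<Sum>t\<in>T. euler_shift m g t * x ^ t / x ^ Suc m)) (at x)"
  proof (intro DERIV_sum)
    fix t assume "t \<in> T"
    have "((\<lambda>x. g t * (x powi (int t - int m))) has_real_derivative
        g t * (of_int (int t - int m) * x powi (int t - int m - 1))) (at x)"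
      using assms by (intro DERIV_cmult) (auto intro!: derivative_eq_intros)
    moreover have "x powi (int t - int m - 1) = x ^ t / x ^ Suc m"
      using assms by (simp add: power_int_diff)
    ultimately have "((\<lambda>x. g t * (x powi (int t - int m))) has_real_derivative
        euler_shift m g t * x ^ t / x ^ Suc m) (at x)"
      by (simp add: algebra_simps diff_divide_distrib)
    then show "((\<lambda>x. g t * x ^ t / x ^ m) has_real_derivative
        euler_shift m g t * x ^ t / x ^ Suc m) (at x)"
    proof (rule has_field_derivative_transform_within_open[where S = "{0<..}"])
      show "g t * (y powi (int t - int m)) = g t * y ^ t / y ^ m" if "y \<in> {0<..}" for y
        using that by (simp add: power_int_diff)
    qed (use assms in auto)
  qed
  then show ?thesis by (simp add: sum_divide_distrib)
qed

text \<open>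
  The coefficient of \<open>x ^ m\<close> that the operator kills is recovered from any root at which \<open>x ^ m\<close> is the
  largest of the powers: a root up to \<open>1\<close> for the least exponent, a root beyond \<open>1\<close> for the greatest.
\<close>

lemma coefficient_bound_from_shift:
  fixes g :: "nat \<Rightarrow> real"
  assumes T: "finite T" "m \<in> T" "0 \<le> B"
    and bound: "\<And>t. t \<in> T \<Longrightarrow> t \<noteq> m \<Longrightarrow> \<bar>euler_shift m g t\<bar> \<le> B"
    and x: "0 < x" "sparse_poly T g x = 0" "\<And>t. t \<in> T \<Longrightarrow> x ^ t \<le> x ^ m"
    and t: "t \<in> T"
  shows "\<bar>g t\<bar> \<le> real (card T) * B"
proof -
  have other: "\<bar>g t\<bar> \<le> B" if "t \<in> T" "t \<noteq> m" for t
  proof -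
    have "1 * \<bar>g t\<bar> \<le> \<bar>real t - real m\<bar> * \<bar>g t\<bar>"
      using \<open>t \<noteq> m\<close> by (intro mult_right_mono) auto
    with bound[OF that] show ?thesis by (simp add: abs_mult)
  qed
  have card: "1 \<le> real (card T)"
    using T(1,2) by (simp add: Suc_le_eq card_gt_0_iff) blast
  show ?thesis
  proof (cases "t = m")
    case False
    with other[OF t] have "1 * \<bar>g t\<bar> \<le> real (card T) * B"
      using card by (intro mult_mono) auto
    then show ?thesis by simp
  next
    case True
    have "g m * x ^ m = - (\<Sum>t\<in>T-{m}. g t * x ^ t)"
      using x(2) T(1,2) by (simp add: sum.remove)
    then have "\<bar>g m * x ^ m\<bar> = \<bar>\<Sum>t\<in>T-{m}. g t * x ^ t\<bar>"
      by (simp only: abs_minus_cancel)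
    then have "\<bar>g m\<bar> * x ^ m = \<bar>\<Sum>t\<in>T-{m}. g t * x ^ t\<bar>"
      using x(1) by (simp add: abs_mult)
    also have "\<dots> \<le> (\<Sum>t\<in>T-{m}. B * x ^ m)"
      using other x T by (intro sum_abs[THEN order_trans] sum_mono) (auto simp: abs_mult intro!: mult_mono)
    also have "\<dots> \<le> (\<Sum>t\<in>T. B * x ^ m)"
      using T x by (intro sum_mono2) auto
    finally show ?thesis using x(1) True by simp
  qed
qed

text \<open>
  The key estimate. The coefficients of a polynomial with prescribed exponents and roots are, up to sign
  and a common factor, generalised Vandermonde determinants of the roots. The lemma compares these
  determinants, provided that the exponents are split by \<open>M\<close> into the same numbers as the roots by \<open>1\<close>.

  The proof is by induction on the number of exponents. Let there be exponents on both sides of \<open>M\<close>. Removing the least exponent with Rolle's theorem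
  leaves \<open>card L - 1\<close> roots up to \<open>1\<close>, \<open>card R - 1\<close> roots beyond \<open>1\<close>, and one root in the gap between the largest
  root up to \<open>1\<close> and the smallest beyond. If this last root lies to the right of \<open>1\<close>, the
  split of the roots again matches that of the exponents. Likewise one may remove the greatest exponent if
  the root in the gap lies to the left of \<open>1\<close>. Where it lies is decided by the sign
  of \<open>(x * q' - m * q) * q\<close> at \<open>1\<close>, a quantity that decreases in \<open>m\<close>; hence one of the two removals always succeeds.
\<close>

lemma coefficient_domination:
  fixes M :: nat
  assumes "finite L" "finite R" "\<And>l. l \<in> L \<Longrightarrow> l < M" "\<And>r. r \<in> R \<Longrightarrow> M < r"
  shows "\<exists>C\<ge>0. \<forall>g U W. finite U \<longrightarrow> finite W \<longrightarrow> card U = card L \<longrightarrow> card W = card R \<longrightarrow>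
           U \<subseteq> {0<..1} \<longrightarrow> W \<subseteq> {1<..} \<longrightarrow>
           (\<forall>x\<in>U \<union> W. sparse_poly (insert M (L \<union> R)) g x = 0) \<longrightarrow>
           (\<forall>t\<in>insert M (L \<union> R). \<bar>g t\<bar> \<le> C * \<bar>g M\<bar>)"
  using assms
proof (induction "card L + card R" arbitrary: L R)
  case 0
  then show ?case by (intro exI[of _ 1]) auto
next
  case (Suc n)
  let ?T = "insert M (L \<union> R)"
  have finT: "finite ?T" using Suc.prems by simp
  define valid where "valid L R C \<longleftrightarrow> (\<forall>g U W. finite U \<longrightarrow> finite W \<longrightarrow> card U = card L \<longrightarrow>
           card W = card R \<longrightarrow> U \<subseteq> {0<..1} \<longrightarrow> W \<subseteq> {1<..} \<longrightarrow>
           (\<forall>x\<in>U \<union> W. sparse_poly (insert M (L \<union> R)) g x = 0) \<longrightarrow>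
           (\<forall>t\<in>insert M (L \<union> R). \<bar>g t\<bar> \<le> C * \<bar>g M\<bar>))" for L R and C :: real
  have "\<exists>C\<ge>0. L \<noteq> {} \<longrightarrow> valid (L - {Min L}) R C"
  proof (cases "L = {}")
    case False
    then have "n = card (L - {Min L}) + card R"
      using Suc.hyps(2) Suc.prems card_gt_0_iff[of L] card_gt_0_iff[of R] by simp
    then have "\<exists>C\<ge>0. valid (L - {Min L}) R C"
      unfolding valid_def using Suc.prems by (intro Suc.hyps(1)) auto
    then show ?thesis by blast
  qed auto
  then obtain C1 where C1: "0 \<le> C1" "L \<noteq> {} \<Longrightarrow> valid (L - {Min L}) R C1" by blast
  have "\<exists>C\<ge>0. R \<noteq> {} \<longrightarrow> valid L (R - {Max R}) C"
  proof (cases "R = {}")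
    case False
    then have "n = card L + card (R - {Max R})"
      using Suc.hyps(2) Suc.prems card_gt_0_iff[of L] card_gt_0_iff[of R] by simp
    then have "\<exists>C\<ge>0. valid L (R - {Max R}) C"
      unfolding valid_def using Suc.prems by (intro Suc.hyps(1)) auto
    then show ?thesis by blast
  qed auto
  then obtain C2 where C2: "0 \<le> C2" "R \<noteq> {} \<Longrightarrow> valid L (R - {Max R}) C2" by blast
  define K1 where "K1 = real (card ?T) * (C1 * \<bar>real M - real (Min L)\<bar>)"
  define K2 where "K2 = real (card ?T) * (C2 * \<bar>real M - real (Max R)\<bar>)"
  have K: "0 \<le> K1" "0 \<le> K2" using C1 C2 by (auto simp: K1_def K2_def)
  have "\<bar>g t\<bar> \<le> (K1 + K2) * \<bar>g M\<bar>"
    if U: "finite U" "card U = card L" "U \<subseteq> {0<..1}"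
      and W: "finite W" "card W = card R" "W \<subseteq> {1<..}"
      and root: "\<And>x. x \<in> U \<union> W \<Longrightarrow> sparse_poly ?T g x = 0" and t: "t \<in> ?T" for g U W t
  proof -
    have drop: "sparse_poly ?T (euler_shift m g) x = sparse_poly (?T - {m}) (euler_shift m g) x"
      for m x using finT by (cases "m \<in> ?T") (simp_all add: sum.remove)
    \<comment> \<open>Enough roots after removal of the least exponent give the claim; the root \<open>u\<close> up to \<open>1\<close> serves for the removed coefficient.\<close>
    have via_min: ?thesis
      if "L \<noteq> {}" "finite U'" "card U' = card L - 1" "U' \<subseteq> {0<..1}"
        "finite W'" "card W' = card R" "W' \<subseteq> {1<..}"
        "\<And>x. x \<in> U' \<union> W' \<Longrightarrow> sparse_poly ?T (euler_shift (Min L) g) x = 0" for U' W'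
    proof -
      let ?m = "Min L"
      have m: "?m \<in> L" using that Suc.prems by simp
      have T': "?T - {?m} = insert M ((L - {?m}) \<union> R)" using m Suc.prems by fastforce
      have "card U' = card (L - {?m})" using that Suc.prems by simp
      then have *: "\<bar>euler_shift ?m g s\<bar> \<le> C1 * \<bar>euler_shift ?m g M\<bar>" if "s \<in> ?T - {?m}" for s
        using C1(2)[OF \<open>L \<noteq> {}\<close>, unfolded valid_def, rule_format, of U' W' "euler_shift ?m g" s]
          \<open>finite U'\<close> \<open>finite W'\<close> \<open>U' \<subseteq> _\<close> \<open>W' \<subseteq> _\<close> \<open>card W' = _\<close> that
          \<open>\<And>x. x \<in> U' \<union> W' \<Longrightarrow> _ x = 0\<close>
        unfolding drop T' by blast
      have "card U \<noteq> 0" using m U(2) Suc.prems by auto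
      then obtain u where u: "u \<in> U" by (auto simp: card_eq_0_iff)
      have "\<bar>g t\<bar> \<le> real (card ?T) * (C1 * \<bar>euler_shift ?m g M\<bar>)"
      proof (rule coefficient_bound_from_shift[OF finT _ _ _ _ _ _ t, of ?m _ _ u])
        show "u ^ s \<le> u ^ ?m" if "s \<in> ?T" for s
        proof (rule power_decreasing)
          have "Min L \<le> M" using m Suc.prems(3) by (simp add: less_imp_le)
          then show "Min L \<le> s"
            using that Suc.prems(1) Suc.prems(4)[of s] Min_le[of L s] by auto
        qed (use subsetD[OF U(3) u] in simp_all)
        show "sparse_poly ?T g u = 0" by (rule root[OF UnI1[OF u]])
        show "0 \<le> C1 * \<bar>euler_shift ?m g M\<bar>" using C1(1) by simp
        show "\<bar>euler_shift ?m g s\<bar> \<le> C1 * \<bar>euler_shift ?m g M\<bar>" if "s \<in> ?T" "s \<noteq> ?m" for s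
          using *[of s] that by blast
        show "?m \<in> ?T" using m by blast
      qed (use subsetD[OF U(3) u] in simp)
      also have "\<dots> = K1 * \<bar>g M\<bar>" by (simp add: K1_def abs_mult)
      also have "\<dots> \<le> (K1 + K2) * \<bar>g M\<bar>" using K by (intro mult_right_mono) auto
      finally show ?thesis .
    qed
    \<comment> \<open>Symmetrically for the greatest exponent, with a root \<open>w\<close> beyond \<open>1\<close>.\<close>
    have via_max: ?thesis
      if "R \<noteq> {}" "finite U'" "card U' = card L" "U' \<subseteq> {0<..1}"
        "finite W'" "card W' = card R - 1" "W' \<subseteq> {1<..}"
        "\<And>x. x \<in> U' \<union> W' \<Longrightarrow> sparse_poly ?T (euler_shift (Max R) g) x = 0" for U' W'
    proof -
      let ?m = "Max R"
      have m: "?m \<in> R" using that Suc.prems by simp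
      have T': "?T - {?m} = insert M (L \<union> (R - {?m}))" using m Suc.prems by fastforce
      have "card W' = card (R - {?m})" using that Suc.prems by simp
      then have *: "\<bar>euler_shift ?m g s\<bar> \<le> C2 * \<bar>euler_shift ?m g M\<bar>" if "s \<in> ?T - {?m}" for s
        using C2(2)[OF \<open>R \<noteq> {}\<close>, unfolded valid_def, rule_format, of U' W' "euler_shift ?m g" s]
          \<open>finite U'\<close> \<open>finite W'\<close> \<open>U' \<subseteq> _\<close> \<open>W' \<subseteq> _\<close> \<open>card U' = _\<close> that
          \<open>\<And>x. x \<in> U' \<union> W' \<Longrightarrow> _ x = 0\<close>
        unfolding drop T' by blast
      have "card W \<noteq> 0" using m W(2) Suc.prems by auto
      then obtain w where w: "w \<in> W" by (auto simp: card_eq_0_iff)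
      have "\<bar>g t\<bar> \<le> real (card ?T) * (C2 * \<bar>euler_shift ?m g M\<bar>)"
      proof (rule coefficient_bound_from_shift[OF finT _ _ _ _ _ _ t, of ?m _ _ w])
        show "w ^ s \<le> w ^ ?m" if "s \<in> ?T" for s
        proof (rule power_increasing)
          have "M \<le> Max R" using m Suc.prems(4) by (simp add: less_imp_le)
          then show "s \<le> Max R"
            using that Suc.prems(2) Suc.prems(3)[of s] Max_ge[of R s] by auto
        qed (use subsetD[OF W(3) w] in simp)
        show "0 < w" using subsetD[OF W(3) w] by simp
        show "sparse_poly ?T g w = 0" by (rule root[OF UnI2[OF w]])
        show "0 \<le> C2 * \<bar>euler_shift ?m g M\<bar>" using C2(1) by simp
        show "\<bar>euler_shift ?m g s\<bar> \<le> C2 * \<bar>euler_shift ?m g M\<bar>" if "s \<in> ?T" "s \<noteq> ?m" for s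
          using *[of s] that by blast
        show "?m \<in> ?T" using m by blast
      qed
      also have "\<dots> = K2 * \<bar>g M\<bar>" by (simp add: K2_def abs_mult)
      also have "\<dots> \<le> (K1 + K2) * \<bar>g M\<bar>" using K by (intro mult_right_mono) auto
      finally show ?thesis .
    qed
    define h where "h m x = sparse_poly ?T g x / x ^ m" for m x
    define h' where "h' m x = sparse_poly ?T (euler_shift m g) x / x ^ Suc m" for m x
    have der: "(h m has_real_derivative h' m x) (at x)" if "0 < x" for m x
      unfolding h_def h'_def by (rule sparse_poly_quotient_deriv[OF that])
    have cont: "continuous_on {a..b} (h' m)" if "0 < a" for a b m
      unfolding h'_def using that by (auto intro!: continuous_intros)
    have h'0: "sparse_poly ?T (euler_shift m g) x = 0" if "h' m x = 0" "0 < x" for m x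
      using that by (auto simp: h'_def)
    have h0: "h m x = 0" if "x \<in> U \<union> W" for m x
      using root[OF that] by (simp add: h_def)
    have rolleU: "\<exists>U'. finite U' \<and> card U' = card L - 1 \<and> U' \<subseteq> {0<..<1} \<and>
        (\<forall>z\<in>U'. h' m z = 0 \<and> (\<exists>y\<in>U. z < y))" for m
    proof -
      have "U \<subseteq> {0<..}" "\<And>x. x \<in> U \<Longrightarrow> h m x = 0" using U h0 by auto
      from rolle_count[OF U(1) this der] obtain Z where Z: "finite Z" "card Z = card U - 1"
        "\<forall>z\<in>Z. h' m z = 0 \<and> (\<exists>x\<in>U. \<exists>y\<in>U. x < z \<and> z < y)" by auto
      moreover have "Z \<subseteq> {0<..<1}"
      proof
        fix z assume "z \<in> Z"
        then obtain x y where "x \<in> U" "y \<in> U" "x < z" "z < y" using Z by blast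
        moreover have "0 < x" "y \<le> 1" using calculation U by auto
        ultimately show "z \<in> {0<..<1}" by auto
      qed
      ultimately show ?thesis using U(2) by (intro exI[of _ Z]) auto
    qed
    have rolleW: "\<exists>W'. finite W' \<and> card W' = card R - 1 \<and> W' \<subseteq> {1<..} \<and>
        (\<forall>z\<in>W'. h' m z = 0 \<and> (\<exists>y\<in>W. y < z))" for m
    proof -
      have "W \<subseteq> {0<..}" "\<And>x. x \<in> W \<Longrightarrow> h m x = 0" using W h0 by force+
      from rolle_count[OF W(1) this der] obtain Z where Z: "finite Z" "card Z = card W - 1"
        "\<forall>z\<in>Z. h' m z = 0 \<and> (\<exists>x\<in>W. \<exists>y\<in>W. x < z \<and> z < y)" by auto
      moreover have "Z \<subseteq> {1<..}"
      proof
        fix z assume "z \<in> Z"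
        then obtain x where "x \<in> W" "x < z" using Z by blast
        moreover have "1 < x" using calculation W by auto
        ultimately show "z \<in> {1<..}" by auto
      qed
      ultimately show ?thesis using W(2) by (intro exI[of _ Z]) auto
    qed
    show ?thesis
    proof (cases "L = {} \<or> R = {}")
      case True
      then show ?thesis
      proof
        assume L: "L = {}"
        then have "R \<noteq> {}" using Suc.hyps(2) by auto
        obtain W' where "finite W'" "card W' = card R - 1" "W' \<subseteq> {1<..}"
          "\<forall>z\<in>W'. h' (Max R) z = 0" using rolleW[of "Max R"] by blast
        with \<open>R \<noteq> {}\<close> L show ?thesis
          by (intro via_max[of "{}" W'] h'0) auto
      next
        assume R: "R = {}"
        then have "L \<noteq> {}" using Suc.hyps(2) by auto
        obtain U' where "finite U'" "card U' = card L - 1" "U' \<subseteq> {0<..<1}"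
          "\<forall>z\<in>U'. h' (Min L) z = 0" using rolleU[of "Min L"] by blast
        with \<open>L \<noteq> {}\<close> R show ?thesis
          by (intro via_min[of U' "{}"] h'0) auto
      qed
    next
      case False
      then have ne: "L \<noteq> {}" "R \<noteq> {}" by auto
      then have UW: "U \<noteq> {}" "W \<noteq> {}" "0 < card L" "0 < card R"
        using U W Suc.prems by (auto simp: card_gt_0_iff)
      let ?u = "Max U" and ?w = "Min W"
      have u: "?u \<in> U" and w: "?w \<in> W" using UW U W by auto
      have u01: "0 < ?u" "?u \<le> 1" using subsetD[OF U(3) u] by simp_all
      have w1: "1 < ?w" using subsetD[OF W(3) w] by simp
      have right: ?thesis if z: "1 < z" "z < ?w" "h' (Min L) z = 0" for z
      proof -
        obtain U' where U': "finite U'" "card U' = card L - 1" "U' \<subseteq> {0<..<1}"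
          "\<forall>z\<in>U'. h' (Min L) z = 0" using rolleU[of "Min L"] by blast
        obtain W' where W': "finite W'" "card W' = card R - 1" "W' \<subseteq> {1<..}"
          "\<forall>x\<in>W'. h' (Min L) x = 0 \<and> (\<exists>y\<in>W. y < x)" using rolleW[of "Min L"] by blast
        have "z \<notin> W'"
        proof
          assume "z \<in> W'"
          then obtain y where "y \<in> W" "y < z" using W' by blast
          with z(2) Min_le[OF W(1), of y] show False by simp
        qed
        show ?thesis
        proof (rule via_min[of U' "insert z W'"])
          show "sparse_poly ?T (euler_shift (Min L) g) x = 0" if "x \<in> U' \<union> insert z W'" for x
          proof (rule h'0)
            show "h' (Min L) x = 0" using that U'(4) W'(4) z(3) by blast
            show "0 < x" using that U'(3) W'(3) z(1) by fastforce
          qed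
          show "card (insert z W') = card R" using \<open>z \<notin> W'\<close> W'(1,2) UW(4) by simp
        qed (use U'(1-3) W'(1,3) z(1) ne(1) in \<open>auto simp: less_imp_le\<close>)
      qed
      show ?thesis
      proof (cases "sparse_poly ?T g 1 = 0")
        \<comment> \<open>If \<open>1\<close> itself is a root, the gap reaches from \<open>1\<close> to \<open>?w\<close>.\<close>
        case True
        have "card {1, ?w} - 1 = 1" using w1 by simp
        moreover have "\<exists>Z'. finite Z' \<and> card Z' = card {1, ?w} - 1 \<and>
           (\<forall>z\<in>Z'. h' (Min L) z = 0 \<and> (\<exists>x\<in>{1, ?w}. \<exists>y\<in>{1, ?w}. x < z \<and> z < y))"
        proof (rule rolle_count)
          show "h (Min L) x = 0" if "x \<in> {1, ?w}" for x
            using that True h0 w by (auto simp: h_def)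
        qed (use der w1 in auto)
        ultimately obtain Z' where Z': "card Z' = 1"
          "\<forall>z\<in>Z'. h' (Min L) z = 0 \<and> (\<exists>x\<in>{1, ?w}. \<exists>y\<in>{1, ?w}. x < z \<and> z < y)" by auto
        then obtain z where "z \<in> Z'" by (metis card_1_singletonE singletonI)
        then have "h' (Min L) z = 0" "\<exists>x\<in>{1, ?w}. \<exists>y\<in>{1, ?w}. x < z \<and> z < y"
          using Z'(2) by blast+
        then show ?thesis using w1 by (intro right[of z]) auto
      next
        case q1: False
        then have "?u < 1" using u01 u root by (metis UnI1 order_le_less)
        show ?thesis
        proof (cases "0 < h (Min L) 1 * h' (Min L) 1")
          case True
          have "\<exists>z. 1 < z \<and> z < ?w \<and> h' (Min L) z = 0"
            using w1 h0 w der True by (intro derivative_zero_to_the_right[where f = "h (Min L)"] cont) auto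
          then show ?thesis using right by blast
        next
          case False
          \<comment> \<open>Passing from \<open>Min L\<close> to \<open>Max R\<close> lowers the product of value and derivative at \<open>1\<close> by a positive multiple of the squared value.\<close>
          have eq: "h' (Max R) 1 = h' (Min L) 1 - (real (Max R) - real (Min L)) * h (Min L) 1"
            by (simp add: h_def h'_def algebra_simps sum_subtractf sum_distrib_left)
          have "Min L \<in> L" "Max R \<in> R" using ne Suc.prems by auto
          then have lt: "Min L < Max R" using Suc.prems(3,4) by (meson less_trans)
          have "h (Max R) 1 * h' (Max R) 1
              = h (Min L) 1 * h' (Min L) 1 - (real (Max R) - real (Min L)) * (h (Min L) 1)\<^sup>2"
            unfolding eq by (simp add: h_def power2_eq_square algebra_simps)
          also have "\<dots> < 0"
          proof -
            have "0 < (real (Max R) - real (Min L)) * (h (Min L) 1)\<^sup>2"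
              using lt q1 by (auto simp: h_def)
            with False show ?thesis by linarith
          qed
          finally have neg: "h (Max R) 1 * h' (Max R) 1 < 0" .
          have "\<exists>z. ?u < z \<and> z < 1 \<and> h' (Max R) z = 0"
            using \<open>?u < 1\<close> h0 u u01 der neg
            by (intro derivative_zero_to_the_left[where f = "h (Max R)"] cont) auto
          then obtain z where z: "?u < z" "z < 1" "h' (Max R) z = 0" by blast
          obtain U' where U': "finite U'" "card U' = card L - 1" "U' \<subseteq> {0<..<1}"
            "\<forall>z\<in>U'. h' (Max R) z = 0 \<and> (\<exists>y\<in>U. z < y)" using rolleU[of "Max R"] by blast
          obtain W' where W': "finite W'" "card W' = card R - 1" "W' \<subseteq> {1<..}"
            "\<forall>x\<in>W'. h' (Max R) x = 0" using rolleW[of "Max R"] by blast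
          have "z \<notin> U'"
          proof
            assume "z \<in> U'"
            then obtain y where "y \<in> U" "z < y" using U' by blast
            with z(1) Max_ge[OF U(1), of y] show False by simp
          qed
          show ?thesis
          proof (rule via_max[of "insert z U'" W'])
            show "sparse_poly ?T (euler_shift (Max R) g) x = 0" if "x \<in> insert z U' \<union> W'" for x
            proof (rule h'0)
              show "h' (Max R) x = 0" using that U'(4) W'(4) z(3) by blast
              show "0 < x" using that U'(3) W'(3) z(1) u01(1) by fastforce
            qed
            show "card (insert z U') = card L" using \<open>z \<notin> U'\<close> U'(1,2) UW(3) by simp
          qed (use U'(1,3) W'(1-3) z(1,2) u01(1) ne(2) in \<open>auto simp: less_imp_le\<close>)
        qed
      qed
    qed
  qed
  then show ?case using K by (intro exI[of _ "K1 + K2"]) auto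
qed

section \<open>Domination of a power by lower and higher powers\<close>

text \<open>
  Fewer equations than unknowns: eliminate one unknown per equation.
\<close>

lemma kernel_vector:
  fixes F :: "'a \<Rightarrow> 'b \<Rightarrow> real"
  assumes "finite P" "finite T" "card P < card T"
  shows "\<exists>g. (\<exists>t\<in>T. g t \<noteq> 0) \<and> (\<forall>u\<in>P. (\<Sum>t\<in>T. g t * F u t) = 0)"
  using assms
proof (induction P arbitrary: T F rule: finite_induct)
  case empty
  then have "T \<noteq> {}" by auto
  then show ?case by (intro exI[of _ "\<lambda>_. 1"]) auto
next
  case (insert u P)
  show ?case
  proof (cases "\<exists>t0\<in>T. F u t0 \<noteq> 0")
    case False
    obtain g where "\<exists>t\<in>T. g t \<noteq> 0" "\<forall>u\<in>P. (\<Sum>t\<in>T. g t * F u t) = 0"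
      using insert.IH[of T F] insert.prems insert.hyps by auto
    with False show ?thesis by (intro exI[of _ g]) auto
  next
    case True
    then obtain t0 where t0: "t0 \<in> T" "F u t0 \<noteq> 0" by blast
    define T' where "T' = T - {t0}"
    have T': "finite T'" "card P < card T'"
      using insert.prems insert.hyps t0 by (auto simp: T'_def)
    obtain g where g: "\<exists>t\<in>T'. g t \<noteq> 0"
      "\<forall>w\<in>P. (\<Sum>t\<in>T'. g t * (F w t - F w t0 * F u t / F u t0)) = 0"
      using insert.IH[OF T', of "\<lambda>w t. F w t - F w t0 * F u t / F u t0"] by blast
    define c where "c = - (\<Sum>t\<in>T'. g t * F u t) / F u t0"
    define h where "h = g(t0 := c)"
    have sum: "(\<Sum>t\<in>T. h t * F w t) = c * F w t0 + (\<Sum>t\<in>T'. g t * F w t)" for w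
    proof -
      have "(\<Sum>t\<in>T. h t * F w t) = h t0 * F w t0 + (\<Sum>t\<in>T'. h t * F w t)"
        using t0 insert.prems by (simp add: T'_def sum.remove)
      also have "(\<Sum>t\<in>T'. h t * F w t) = (\<Sum>t\<in>T'. g t * F w t)"
        by (intro sum.cong) (auto simp: h_def T'_def)
      finally show ?thesis by (simp add: h_def)
    qed
    have "(\<Sum>t\<in>T. h t * F w t) = 0" if "w \<in> insert u P" for w
    proof (cases "w = u")
      case True
      then show ?thesis using t0 by (simp add: sum c_def)
    next
      case False
      with that g have "0 = (\<Sum>t\<in>T'. g t * (F w t - F w t0 * F u t / F u t0))" by auto
      also have "\<dots> = (\<Sum>t\<in>T'. g t * F w t) - (\<Sum>t\<in>T'. g t * F u t * (F w t0 / F u t0))"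
        by (simp add: algebra_simps sum_subtractf)
      also have "\<dots> = (\<Sum>t\<in>T. h t * F w t)"
        by (simp add: sum c_def sum_distrib_right sum_divide_distrib)
      finally show ?thesis by simp
    qed
    moreover have "\<exists>t\<in>T. h t \<noteq> 0" using g(1) by (auto simp: h_def T'_def)
    ultimately show ?thesis by blast
  qed
qed

text \<open>
  Interpolation of \<open>x ^ M\<close> with coefficients bounded independently of the nodes. The bound comes from
  \<open>coefficient_domination\<close>, applied to a polynomial through the nodes in which the numbers of exponents
  below and above \<open>M\<close> are those of the nodes up to \<open>1\<close> and beyond \<open>1\<close>; one takes the sum of the bounds
  over all such splittings.
\<close>

lemma bounded_interpolation:
  fixes M N :: nat
  assumes L: "finite L" "card L = N" "\<And>l. l \<in> L \<Longrightarrow> l < M"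
    and S: "finite S" "card S = N" "\<And>s. s \<in> S \<Longrightarrow> M < s"
  shows "\<exists>C\<ge>0. \<forall>P. finite P \<longrightarrow> card P = N \<longrightarrow> P \<subseteq> {0<..} \<longrightarrow>
           (\<exists>\<alpha>. (\<forall>x\<in>P. x ^ M = sparse_poly (L \<union> S) \<alpha> x) \<and> (\<forall>t. \<bar>\<alpha> t\<bar> \<le> C))"
proof -
  define good where "good k C \<longleftrightarrow> (\<forall>P. finite P \<longrightarrow> card P = N \<longrightarrow> P \<subseteq> {0<..} \<longrightarrow>
      card (P \<inter> {..1}) = k \<longrightarrow>
      (\<exists>\<alpha>. (\<forall>x\<in>P. x ^ M = sparse_poly (L \<union> S) \<alpha> x) \<and> (\<forall>t. \<bar>\<alpha> t\<bar> \<le> C)))" for k C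
  have "\<exists>C. 0 \<le> C \<and> good k C" if "k \<le> N" for k
  proof -
    obtain L' where L': "L' \<subseteq> L" "card L' = k" "finite L'"
      using obtain_subset_with_card_n[of k L] \<open>k \<le> N\<close> L(2) by blast
    obtain R where R: "R \<subseteq> S" "card R = N - k" "finite R"
      using obtain_subset_with_card_n[of "N - k" S] S(2) by (metis diff_le_self)
    let ?T = "L' \<union> R"
    have MT: "M \<notin> ?T" using L(3) S(3) L'(1) R(1) by blast
    have disj: "L' \<inter> R = {}" using L(3) S(3) L'(1) R(1) by fastforce
    have LR: "\<And>l. l \<in> L' \<Longrightarrow> l < M" "\<And>r. r \<in> R \<Longrightarrow> M < r"
      using L(3) S(3) L'(1) R(1) by blast+
    obtain C where C: "0 \<le> C" "\<And>g U W. finite U \<Longrightarrow> finite W \<Longrightarrow> card U = card L' \<Longrightarrow> card W = card R \<Longrightarrow>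
           U \<subseteq> {0<..1} \<Longrightarrow> W \<subseteq> {1<..} \<Longrightarrow>
           (\<forall>x\<in>U \<union> W. sparse_poly (insert M ?T) g x = 0) \<Longrightarrow>
           (\<forall>t\<in>insert M ?T. \<bar>g t\<bar> \<le> C * \<bar>g M\<bar>)"
      using coefficient_domination[OF L'(3) R(3) LR] by blast
    have "\<exists>\<alpha>. (\<forall>x\<in>P. x ^ M = sparse_poly (L \<union> S) \<alpha> x) \<and> (\<forall>t. \<bar>\<alpha> t\<bar> \<le> C)"
      if P: "finite P" "card P = N" "P \<subseteq> {0<..}" "card (P \<inter> {..1}) = k" for P
    proof -
      have "card (insert M ?T) = Suc N"
        using MT disj L' R \<open>k \<le> N\<close> by (simp add: card_Un_disjoint)
      with P obtain g where g: "\<exists>t\<in>insert M ?T. g t \<noteq> 0"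
        "\<And>x. x \<in> P \<Longrightarrow> sparse_poly (insert M ?T) g x = 0"
        using kernel_vector[of P "insert M ?T" "\<lambda>x t. x ^ t"] L'(3) R(3) by auto
      have "card P = card (P \<inter> {..1}) + card (P \<inter> {1<..})"
        using P(1) by (subst card_Un_disjoint[symmetric]) (auto intro!: arg_cong[where f = card])
      then have "card (P \<inter> {1<..}) = card R" using P R by simp
      have "\<forall>t\<in>insert M ?T. \<bar>g t\<bar> \<le> C * \<bar>g M\<bar>"
      proof (rule C(2))
        show "finite (P \<inter> {..1})" "finite (P \<inter> {1<..})" using P(1) by simp_all
        show "card (P \<inter> {..1}) = card L'" using P(4) L'(2) by simp
        show "P \<inter> {..1} \<subseteq> {0<..1}" using P(3) by auto
        show "\<forall>x\<in>P \<inter> {..1} \<union> P \<inter> {1<..}. sparse_poly (insert M ?T) g x = 0"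
          using g(2) by blast
      qed (use \<open>card (P \<inter> {1<..}) = card R\<close> in simp_all)
      then have bound: "\<bar>g t\<bar> \<le> C * \<bar>g M\<bar>" if "t \<in> insert M ?T" for t
        using that by (rule bspec)
      have gM: "g M \<noteq> 0"
      proof
        assume "g M = 0"
        then have "g t = 0" if "t \<in> insert M ?T" for t using bound[OF that] by simp
        with g(1) show False by blast
      qed
      define \<alpha> where "\<alpha> t = (if t \<in> ?T then - g t / g M else 0)" for t
      have "\<bar>\<alpha> t\<bar> \<le> C" for t
      proof (cases "t \<in> ?T")
        case True
        then have "\<bar>g t\<bar> \<le> C * \<bar>g M\<bar>" by (intro bound) simp
        then show ?thesis using gM True by (simp add: \<alpha>_def divide_le_eq)
      qed (use C(1) in \<open>simp add: \<alpha>_def\<close>)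
      moreover have "x ^ M = sparse_poly (L \<union> S) \<alpha> x" if "x \<in> P" for x
      proof -
        have "0 = g M * x ^ M + sparse_poly ?T g x"
          using g(2)[OF that] MT L'(3) R(3) by simp
        then have "x ^ M = - sparse_poly ?T g x / g M" using gM by (simp add: field_simps)
        also have "\<dots> = sparse_poly ?T \<alpha> x"
          by (simp add: \<alpha>_def sum_divide_distrib sum_negf)
        also have "\<dots> = sparse_poly (L \<union> S) \<alpha> x"
          using L'(1) R(1) L(1) S(1) by (intro sum.mono_neutral_left) (auto simp: \<alpha>_def)
        finally show ?thesis .
      qed
      ultimately show ?thesis by blast
    qed
    then have "good k C" by (simp add: good_def)
    with C(1) show ?thesis by blast
  qed
  then have "\<exists>C. \<forall>k\<in>{..N}. 0 \<le> C k \<and> good k (C k)" by (intro bchoice) blast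
  then obtain C where C: "\<And>k. k \<le> N \<Longrightarrow> 0 \<le> C k" "\<And>k. k \<le> N \<Longrightarrow> good k (C k)" by blast
  show ?thesis
  proof (intro exI[of _ "\<Sum>k\<le>N. C k"] conjI allI impI)
    show "0 \<le> (\<Sum>k\<le>N. C k)" using C(1) by (intro sum_nonneg) auto
    fix P :: "real set" assume P: "finite P" "card P = N" "P \<subseteq> {0<..}"
    let ?k = "card (P \<inter> {..1})"
    have k: "?k \<le> N" using P(1,2) by (metis Int_lower1 card_mono)
    obtain \<alpha> where "\<forall>x\<in>P. x ^ M = sparse_poly (L \<union> S) \<alpha> x" "\<forall>t. \<bar>\<alpha> t\<bar> \<le> C ?k"
      using C(2)[OF k] P unfolding good_def by blast
    moreover have "C ?k \<le> (\<Sum>k\<le>N. C k)"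
      using k C(1) by (intro member_le_sum) auto
    ultimately show "\<exists>\<alpha>. (\<forall>x\<in>P. x ^ M = sparse_poly (L \<union> S) \<alpha> x) \<and> (\<forall>t. \<bar>\<alpha> t\<bar> \<le> (\<Sum>k\<le>N. C k))"
      by (meson order_trans)
  qed
qed

text \<open>
  The rank one case. A combination of evaluations at at most \<open>N\<close> points is applied to an interpolation
  of \<open>x ^ M\<close> at these points. Coinciding points and too few points do no harm, since the set of
  nodes can be filled up to \<open>N\<close> elements.
\<close>

lemma moment_domination:
  fixes M N :: nat
  assumes L: "finite L" "card L = N" "\<And>l. l \<in> L \<Longrightarrow> l < M"
    and S: "finite S" "card S = N" "\<And>s. s \<in> S \<Longrightarrow> M < s"
  shows "\<exists>K\<ge>0. \<forall>m\<le>N. \<forall>u v :: nat \<Rightarrow> real. (\<forall>i<m. 0 < u i) \<longrightarrow>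
           (\<Sum>i<m. v i * u i ^ M)\<^sup>2 \<le> K * (\<Sum>t\<in>L \<union> S. (\<Sum>i<m. v i * u i ^ t)\<^sup>2)"
proof -
  let ?T = "L \<union> S"
  obtain C where C: "0 \<le> C" "\<And>P. finite P \<Longrightarrow> card P = N \<Longrightarrow> P \<subseteq> {0<..} \<Longrightarrow>
           (\<exists>\<alpha>. (\<forall>x\<in>P. x ^ M = sparse_poly ?T \<alpha> x) \<and> (\<forall>t. \<bar>\<alpha> t\<bar> \<le> C))"
    using bounded_interpolation[OF L S] by blast
  show ?thesis
  proof (intro exI[of _ "C\<^sup>2 * real (card ?T)"] conjI allI impI)
    fix m and u v :: "nat \<Rightarrow> real" assume m: "m \<le> N" and u: "\<forall>i<m. 0 < u i"
    define J where "J t = (\<Sum>i<m. v i * u i ^ t)" for t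
    have cu: "card (u ` {..<m}) \<le> N" using card_image_le[of "{..<m}" u] m by simp
    have "infinite ({0::real<..} - u ` {..<m})" by (intro Diff_infinite_finite infinite_Ioi) auto
    from infinite_arbitrarily_large[OF this, of "N - card (u ` {..<m})"]
    obtain Q where Q: "finite Q" "card Q = N - card (u ` {..<m})" "Q \<subseteq> {0<..} - u ` {..<m}" by blast
    have "card (u ` {..<m} \<union> Q) = card (u ` {..<m}) + card Q"
      using Q by (intro card_Un_disjoint) auto
    then have "card (u ` {..<m} \<union> Q) = N" using Q(2) cu by simp
    moreover have "u ` {..<m} \<union> Q \<subseteq> {0<..}" using Q u by auto
    ultimately obtain \<alpha> where \<alpha>: "\<And>i. i < m \<Longrightarrow> u i ^ M = sparse_poly ?T \<alpha> (u i)" "\<And>t. \<bar>\<alpha> t\<bar> \<le> C"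
      using C(2)[of "u ` {..<m} \<union> Q"] Q(1) by auto
    have "J M = (\<Sum>i<m. \<Sum>t\<in>?T. \<alpha> t * (v i * u i ^ t))"
      unfolding J_def by (intro sum.cong) (auto simp: \<alpha>(1) sum_distrib_left mult.left_commute)
    also have "\<dots> = (\<Sum>t\<in>?T. \<alpha> t * J t)"
      by (subst sum.swap) (simp add: J_def sum_distrib_left)
    finally have "\<bar>J M\<bar> \<le> (\<Sum>t\<in>?T. C * \<bar>J t\<bar>)"
      using \<alpha>(2) by (auto simp: abs_mult intro!: sum_abs[THEN order_trans] sum_mono mult_right_mono)
    then have "\<bar>J M\<bar> \<le> C * (\<Sum>t\<in>?T. \<bar>J t\<bar>)" by (simp add: sum_distrib_left)
    then have "(J M)\<^sup>2 \<le> (C * (\<Sum>t\<in>?T. \<bar>J t\<bar>))\<^sup>2" by (simp add: abs_le_square_iff[symmetric])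
    also have "\<dots> = C\<^sup>2 * (\<Sum>t\<in>?T. \<bar>J t\<bar>)\<^sup>2" by (simp add: power_mult_distrib)
    also have "\<dots> \<le> C\<^sup>2 * ((\<Sum>t\<in>?T. \<bar>J t\<bar>\<^sup>2) * real (card ?T))"
      using sum_squared_le_sum_of_squares[of "\<lambda>t. \<bar>J t\<bar>" ?T] by (intro mult_left_mono) (auto simp: mult.commute)
    finally show "(\<Sum>i<m. v i * u i ^ M)\<^sup>2
        \<le> C\<^sup>2 * real (card ?T) * (\<Sum>t\<in>?T. (\<Sum>i<m. v i * u i ^ t)\<^sup>2)"
      by (simp add: J_def mult_ac)
  qed simp
qed

lemma qform_power_rank_one:
  "qform m (\<lambda>i j. (u i * u j) ^ t) v = (\<Sum>i<m. v i * u i ^ t)\<^sup>2"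
  using qform_rank_one[of m "\<lambda>i. u i ^ t" v] by (simp add: power_mult_distrib)

text \<open>
  Rank one matrices are covered by \<open>moment_domination\<close>. For the extension to higher rank, the derivative of
  \<open>K * (\<Sum>t\<in>L \<union> S. x ^ t) - x ^ M\<close> has, up to positive factors, the same form with all exponents lowered by one, and matrices of
  size \<open>N\<close> are enough for it. So the least and the greatest exponent may be dropped, and after this
  no exponent is \<open>0\<close>, so that lowering is injective.
\<close>

lemma psd_power_domination:
  fixes M N :: nat
  assumes "finite L" "card L = N" "\<And>l. l \<in> L \<Longrightarrow> l < M"
    and "finite S" "card S = N" "\<And>s. s \<in> S \<Longrightarrow> M < s"
  shows "\<exists>K\<ge>0. \<forall>m\<le>N. \<forall>a v. psd m a \<longrightarrow> (\<forall>i<m. \<forall>j<m. 0 < a i j) \<longrightarrow>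
           qform m (\<lambda>i j. a i j ^ M) v \<le> K * (\<Sum>t\<in>L \<union> S. qform m (\<lambda>i j. a i j ^ t) v)"
  using assms
proof (induction N arbitrary: L S M)
  case 0
  show ?case by (intro exI[of _ 0]) (simp add: qform_def)
next
  case (Suc N)
  let ?T = "L \<union> S"
  have ne: "L \<noteq> {}" "S \<noteq> {}" using Suc.prems by auto
  then have mem: "Min L \<in> L" "Max S \<in> S" using Suc.prems by auto
  have disj: "L \<inter> S = {}" using Suc.prems(3,6) by fastforce
  define L' where "L' = (\<lambda>t. t - 1) ` (L - {Min L})"
  define S' where "S' = (\<lambda>t. t - 1) ` (S - {Max S})"
  have Lpos: "0 < t" if "t \<in> L - {Min L}" for t
    using that Suc.prems(1) Min_le[of L t] by (cases t) auto
  have Spos: "0 < t" if "t \<in> S" for t using that Suc.prems(6)[of t] by simp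
  have Mpos: "0 < M" using mem(1) Suc.prems(3)[of "Min L"] by simp
  have inj: "inj_on (\<lambda>t. t - 1) (L - {Min L} \<union> (S - {Max S}))"
  proof (rule inj_onI)
    fix x y :: nat
    assume "x \<in> L - {Min L} \<union> (S - {Max S})" "y \<in> L - {Min L} \<union> (S - {Max S})" "x - 1 = y - 1"
    moreover have "0 < x" "0 < y" using calculation(1,2) Lpos Spos by blast+
    ultimately show "x = y" by linarith
  qed
  have "card L' = card (L - {Min L})" "card S' = card (S - {Max S})"
    unfolding L'_def S'_def by (intro card_image inj_on_subset[OF inj] Un_upper1 Un_upper2)+
  then have cards: "card L' = N" "card S' = N" using Suc.prems(1,2,4,5) mem by simp_all
  have "\<exists>K\<ge>0. \<forall>m\<le>N. \<forall>a v. psd m a \<longrightarrow> (\<forall>i<m. \<forall>j<m. 0 < a i j) \<longrightarrow>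
      qform m (\<lambda>i j. a i j ^ (M - 1)) v \<le> K * (\<Sum>t\<in>L' \<union> S'. qform m (\<lambda>i j. a i j ^ t) v)"
  proof (rule Suc.IH[OF _ cards(1) _ _ cards(2)])
    show "l < M - 1" if "l \<in> L'" for l
    proof -
      obtain t where "t \<in> L - {Min L}" "l = t - 1" using \<open>l \<in> L'\<close> unfolding L'_def by blast
      with Lpos[of t] Suc.prems(3)[of t] show ?thesis by auto
    qed
    show "M - 1 < s" if "s \<in> S'" for s
    proof -
      obtain t where "t \<in> S" "s = t - 1" using \<open>s \<in> S'\<close> unfolding S'_def by blast
      with Mpos Suc.prems(6)[of t] show ?thesis by auto
    qed
    show "finite L'" "finite S'" using Suc.prems(1,4) by (simp_all add: L'_def S'_def)
  qed
  then obtain K2 where K2: "0 \<le> K2" "\<forall>m\<le>N. \<forall>a v. psd m a \<longrightarrow> (\<forall>i<m. \<forall>j<m. 0 < a i j) \<longrightarrow>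
      qform m (\<lambda>i j. a i j ^ (M - 1)) v \<le> K2 * (\<Sum>t\<in>L' \<union> S'. qform m (\<lambda>i j. a i j ^ t) v)"
    by (elim exE conjE)
  obtain K1 where K1: "0 \<le> K1" "\<forall>m\<le>Suc N. \<forall>u v :: nat \<Rightarrow> real. (\<forall>i<m. 0 < u i) \<longrightarrow>
      (\<Sum>i<m. v i * u i ^ M)\<^sup>2 \<le> K1 * (\<Sum>t\<in>?T. (\<Sum>i<m. v i * u i ^ t)\<^sup>2)"
    using moment_domination[of L "Suc N" M S] Suc.prems by auto
  \<comment> \<open>\<open>K1\<close> serves the rank one case; \<open>M * K2\<close> serves the derivative, where \<open>x ^ M\<close> contributes the factor \<open>M\<close>.\<close>
  define K where "K = K1 + real M * K2"
  have K: "K1 \<le> K" "real M * K2 \<le> K" "0 \<le> K" using K1 K2 by (auto simp: K_def)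
  define P where "P x = K * (\<Sum>t\<in>?T. x ^ t) - x ^ M" for x :: real
  define P' where "P' x = K * (\<Sum>t\<in>?T. real t * x ^ (t - 1)) - real M * x ^ (M - 1)" for x :: real
  have qP: "qform m (\<lambda>i j. P (a i j)) v
      = K * (\<Sum>t\<in>?T. qform m (\<lambda>i j. a i j ^ t) v) - qform m (\<lambda>i j. a i j ^ M) v" for m a v
    by (simp only: P_def qform_diff qform_scale qform_sum)
  have qP': "qform m (\<lambda>i j. P' (a i j)) v
      = K * (\<Sum>t\<in>?T. real t * qform m (\<lambda>i j. a i j ^ (t - 1)) v) - real M * qform m (\<lambda>i j. a i j ^ (M - 1)) v"
    for m a v by (simp only: P'_def qform_diff qform_scale qform_sum)
  have "qform m (\<lambda>i j. a i j ^ M) v \<le> K * (\<Sum>t\<in>?T. qform m (\<lambda>i j. a i j ^ t) v)"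
    if m: "m \<le> Suc N" and a: "psd m a" and pos: "\<forall>i<m. \<forall>j<m. 0 < a i j" for m a v
  proof (cases m)
    case 0
    then show ?thesis by (simp add: qform_def)
  next
    case (Suc m')
    have "0 \<le> qform (Suc m') (\<lambda>i j. P (a i j)) v"
    proof (rule preserves_psd_extension[where P = P and P' = P' and a = a])
      show "psd (Suc m') a" using a Suc by simp
      show "0 < a i j" if "i \<le> m'" "j \<le> m'" for i j using that pos Suc by simp
      show "(P has_real_derivative P' x) (at x)" for x
        unfolding P_def P'_def
        by (intro DERIV_diff DERIV_cmult DERIV_sum) (auto intro!: derivative_eq_intros)
      show "0 \<le> qform (Suc m') (\<lambda>i j. P (u i * u j)) v" if "\<And>i. i \<le> m' \<Longrightarrow> 0 < u i" for u
      proof -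
        have "(\<Sum>i<Suc m'. v i * u i ^ M)\<^sup>2 \<le> K1 * (\<Sum>t\<in>?T. (\<Sum>i<Suc m'. v i * u i ^ t)\<^sup>2)"
          using that m Suc by (intro K1(2)[rule_format]) auto
        also have "\<dots> \<le> K * (\<Sum>t\<in>?T. (\<Sum>i<Suc m'. v i * u i ^ t)\<^sup>2)"
          by (intro mult_right_mono K sum_nonneg) auto
        finally show ?thesis by (simp only: qP qform_power_rank_one diff_ge_0_iff_ge)
      qed
      fix b w assume b: "psd m' b" "\<And>i j. i < m' \<Longrightarrow> j < m' \<Longrightarrow> 0 < b i j"
      let ?q = "\<lambda>t. qform m' (\<lambda>i j. b i j ^ t) w"
      have q: "0 \<le> ?q t" for t by (intro psd_qform psd_power b)
      have "real M * ?q (M - 1) \<le> real M * (K2 * (\<Sum>t\<in>L' \<union> S'. ?q t))"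
        using m Suc b by (intro mult_left_mono K2(2)[rule_format]) auto
      also have "\<dots> = (real M * K2) * (\<Sum>t\<in>L' \<union> S'. ?q t)" by simp
      also have "\<dots> \<le> K * (\<Sum>t\<in>L' \<union> S'. ?q t)"
        by (intro mult_right_mono K sum_nonneg q)
      also have "(\<Sum>t\<in>L' \<union> S'. ?q t) = (\<Sum>t\<in>L - {Min L} \<union> (S - {Max S}). ?q (t - 1))"
        unfolding L'_def S'_def image_Un[symmetric] using inj by (simp add: sum.reindex)
      also have "\<dots> \<le> (\<Sum>t\<in>L - {Min L} \<union> (S - {Max S}). real t * ?q (t - 1))"
      proof (rule sum_mono)
        fix t assume "t \<in> L - {Min L} \<union> (S - {Max S})"
        then have "0 < t" using Lpos[of t] Spos[of t] by blast
        then have "1 * ?q (t - 1) \<le> real t * ?q (t - 1)" by (intro mult_right_mono q) simp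
        then show "?q (t - 1) \<le> real t * ?q (t - 1)" by simp
      qed
      also have "\<dots> \<le> (\<Sum>t\<in>?T. real t * ?q (t - 1))"
        using Suc.prems(1,4) by (intro sum_mono2) (auto intro: mult_nonneg_nonneg q)
      finally show "0 \<le> qform m' (\<lambda>i j. P' (b i j)) w"
        using K(3) by (simp add: qP' mult_left_mono)
    qed
    then show ?thesis by (simp add: qP Suc)
  qed
  then show ?case using K(3) by blast
qed

section \<open>Minors and Fekete's criterion\<close>

text \<open>
  Rows and columns are chosen by functions instead of sets: deleting the chosen row \<open>k\<close> is then
  composition with \<open>insert_index k\<close>, which skips \<open>k\<close>.
\<close>

definition minor :: "(nat \<Rightarrow> nat \<Rightarrow> real) \<Rightarrow> nat \<Rightarrow> (nat \<Rightarrow> nat) \<Rightarrow> (nat \<Rightarrow> nat) \<Rightarrow> real" where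
  "minor a p r c = Determinant.det (Matrix.mat p p (\<lambda>(i, j). a (r i) (c j)))"

definition selection :: "nat \<Rightarrow> nat \<Rightarrow> (nat \<Rightarrow> nat) \<Rightarrow> bool" where
  "selection p n r \<longleftrightarrow> strict_mono_on {..<p} r \<and> (\<forall>i<p. r i < n)"

lemma selectionD:
  assumes "selection p n r"
  shows "i < j \<Longrightarrow> j < p \<Longrightarrow> r i < r j" "i < p \<Longrightarrow> r i < n"
  using assms by (auto simp: selection_def strict_mono_on_def)

lemma selectionI:
  assumes "\<And>i j. i < j \<Longrightarrow> j < p \<Longrightarrow> r i < r j" "\<And>i. i < p \<Longrightarrow> r i < n"
  shows "selection p n r"
  using assms by (auto simp: selection_def strict_mono_on_def)

lemma selection_insert_index:
  assumes "selection (Suc p) n r"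
  shows "selection p n (r \<circ> insert_index k)"
  using selectionD[OF assms] by (intro selectionI) (auto simp: insert_index_def)

lemma selection_Suc:
  assumes "selection (Suc p) n r"
  shows "selection p n (r \<circ> Suc)" "selection p n r"
  using selectionD[OF assms] by (auto intro!: selectionI)

lemma minor_cong:
  assumes "\<And>i. i < p \<Longrightarrow> r i = r' i" "\<And>i. i < p \<Longrightarrow> c i = c' i"
  shows "minor a p r c = minor a p r' c'"
  unfolding minor_def using assms by (intro arg_cong[where f = Determinant.det] eq_matI) auto

lemma minor_0: "minor a 0 r c = 1"
  unfolding minor_def by (rule det_dim_zero) auto

lemma minor_transpose: "minor (\<lambda>i j. a j i) p c r = minor a p r c"
proof -
  let ?A = "Matrix.mat p p (\<lambda>(i, j). a (r i) (c j))"
  have "transpose_mat ?A = Matrix.mat p p (\<lambda>(i, j). a (r j) (c i))"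
    by (intro eq_matI) auto
  then show ?thesis unfolding minor_def using det_transpose[of ?A p] by simp
qed

text \<open>
  Among \<open>p + 1\<close> rows of length \<open>p\<close> there is a linear relation, whose coefficients are the signed maximal
  minors: expand the determinant in which column \<open>j\<close> occurs twice.
\<close>

lemma minor_relation:
  assumes "j < p"
  shows "(\<Sum>k\<le>p. (-1) ^ k * minor a p (r \<circ> insert_index k) c * a (r k) (c j)) = 0"
proof -
  define B where "B = Matrix.mat (Suc p) (Suc p) (\<lambda>(i, k). a (r i) (c (if k = 0 then j else k - 1)))"
  have B: "B \<in> carrier_mat (Suc p) (Suc p)" by (simp add: B_def)
  have "0 = Determinant.det B"
  proof (rule det_identical_columns[OF B, of 0 "Suc j", symmetric])
    show "Matrix.col B 0 = Matrix.col B (Suc j)"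
      using assms by (intro eq_vecI) (auto simp: B_def)
  qed (use assms in auto)
  also have "\<dots> = (\<Sum>k<Suc p. B $$ (k, 0) * cofactor B k 0)"
    by (rule laplace_expansion_column[OF B]) simp
  also have "\<dots> = (\<Sum>k\<le>p. (-1) ^ k * minor a p (r \<circ> insert_index k) c * a (r k) (c j))"
  proof (rule sum.cong)
    fix k assume "k \<in> {..p}"
    then have k: "k < Suc p" by simp
    have "mat_delete B k 0 = Matrix.mat p p (\<lambda>(i, j). a ((r \<circ> insert_index k) i) (c j))"
      using k by (intro eq_matI) (auto simp: mat_delete_def B_def insert_index_def)
    then have "cofactor B k 0 = (-1) ^ k * minor a p (r \<circ> insert_index k) c"
      by (simp add: cofactor_def minor_def)
    moreover have "B $$ (k, 0) = a (r k) (c j)" using k by (simp add: B_def)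
    ultimately show "B $$ (k, 0) * cofactor B k 0
        = (-1) ^ k * minor a p (r \<circ> insert_index k) c * a (r k) (c j)" by simp
  qed auto
  finally show ?thesis by simp
qed

lemma minor_nonzero_kernel:
  assumes "minor a p r c \<noteq> 0" "\<And>j. j < p \<Longrightarrow> (\<Sum>i<p. z i * a (r i) (c j)) = 0" "i < p"
  shows "z i = 0"
proof (rule ccontr)
  assume z: "z i \<noteq> 0"
  let ?A = "Matrix.mat p p (\<lambda>(i, j). a (r j) (c i))"
  let ?v = "Matrix.vec p z"
  have "?A *\<^sub>v ?v = 0\<^sub>v p"
    using assms(2) by (intro eq_vecI) (auto simp: scalar_prod_def mult.commute atLeast0LessThan)
  moreover have "?v \<noteq> 0\<^sub>v p"
  proof
    assume "?v = 0\<^sub>v p"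
    then have "Matrix.vec_index ?v i = Matrix.vec_index (0\<^sub>v p) i" by simp
    with z assms(3) show False by simp
  qed
  ultimately have "Determinant.det ?A = 0"
    by (subst det_0_iff_vec_prod_zero_field[of _ p]) (auto intro!: exI[of _ ?v])
  moreover have "Determinant.det ?A = minor a p r c"
    using minor_transpose[of a p c r] by (simp add: minor_def)
  ultimately show False using assms(1) by simp
qed

text \<open>
  A three-term Pluecker relation between the minors of \<open>q + 2\<close> rows. The rows, cut to their first \<open>q\<close>
  entries, satisfy three linear relations: the one from all rows (with minors of size \<open>q + 1\<close>) and those without
  the last and without the first row (with minors of size \<open>q\<close>). Combine them so that the
  first and the last row drop out. The remaining \<open>q\<close> rows are independent, so the combination is trivial,
  and the claim is its coefficient at row \<open>Suc l\<close>. Using relations rather than reordered determinants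
  avoids all signs of permutations.
\<close>

lemma minor_three_term:
  fixes q l :: nat
  assumes l: "l < q" and nz: "minor a q (r \<circ> Suc) c \<noteq> 0"
  shows "minor a (Suc q) (r \<circ> insert_index (Suc l)) c * minor a q (r \<circ> Suc) c
    = minor a (Suc q) (r \<circ> Suc) c * minor a q (r \<circ> insert_index (Suc l)) c
      + minor a (Suc q) r c * minor a q (r \<circ> Suc \<circ> insert_index l) c"
proof -
  define d where "d = minor a q (r \<circ> Suc) c"
  define M where "M k = minor a (Suc q) (r \<circ> insert_index k) c" for k
  define y where "y k = (-1) ^ k * M k" for k
  define y1 where "y1 k = (if k \<le> q then (-1) ^ k * minor a q (r \<circ> insert_index k) c else 0)" for k
  define y2 where "y2 k = (if k = 0 then 0 else (-1) ^ (k - 1) * minor a q (r \<circ> Suc \<circ> insert_index (k - 1)) c)" for k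
  have M0: "M 0 = minor a (Suc q) (r \<circ> Suc) c"
    unfolding M_def by (intro minor_cong) (auto simp: insert_index_def)
  have Mq: "M (Suc q) = minor a (Suc q) r c"
    unfolding M_def by (intro minor_cong) (auto simp: insert_index_def)
  have y10: "y1 0 = d"
    unfolding y1_def d_def by (simp add: insert_index_def o_def)
  have y2q: "y2 (Suc q) = (-1) ^ q * d"
  proof -
    have "minor a q (r \<circ> Suc \<circ> insert_index q) c = d"
      unfolding d_def by (intro minor_cong) (auto simp: insert_index_def)
    then show ?thesis by (simp add: y2_def)
  qed
  define z where "z k = d * y k - M 0 * y1 k + M (Suc q) * y2 k" for k
  have z0: "z 0 = 0" by (simp add: z_def y10 y_def y2_def)
  have zq: "z (Suc q) = 0" by (simp add: z_def y2q y_def y1_def)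
  have "z (Suc i) = 0" if "i < q" for i
  proof (rule minor_nonzero_kernel[of a q "r \<circ> Suc" c "\<lambda>i. z (Suc i)"])
    fix j assume j: "j < q"
    have s: "(\<Sum>k\<le>Suc q. y k * a (r k) (c j)) = 0"
      unfolding y_def M_def using j by (intro minor_relation) simp
    have "(\<Sum>k\<le>Suc q. y1 k * a (r k) (c j)) = (\<Sum>k\<le>q. y1 k * a (r k) (c j))"
      by (simp add: y1_def)
    also have "\<dots> = 0"
      using minor_relation[OF j, of a r c] by (simp add: y1_def)
    finally have s1: "(\<Sum>k\<le>Suc q. y1 k * a (r k) (c j)) = 0" .
    have "(\<Sum>k\<le>Suc q. y2 k * a (r k) (c j)) = (\<Sum>k\<le>q. y2 (Suc k) * a (r (Suc k)) (c j))"
      by (simp add: sum.atMost_Suc_shift y2_def del: sum.atMost_Suc)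
    also have "\<dots> = 0"
      using minor_relation[OF j, of a "r \<circ> Suc" c] by (simp add: y2_def)
    finally have s2: "(\<Sum>k\<le>Suc q. y2 k * a (r k) (c j)) = 0" .
    have "(\<Sum>k\<le>Suc q. z k * a (r k) (c j)) = d * (\<Sum>k\<le>Suc q. y k * a (r k) (c j))
        - M 0 * (\<Sum>k\<le>Suc q. y1 k * a (r k) (c j)) + M (Suc q) * (\<Sum>k\<le>Suc q. y2 k * a (r k) (c j))"
      unfolding z_def sum_distrib_left sum.distrib[symmetric] sum_subtractf[symmetric]
      by (intro sum.cong refl) (simp add: algebra_simps)
    also have "\<dots> = 0" unfolding s s1 s2 by simp
    finally have "(\<Sum>k\<le>q. z (Suc k) * a (r (Suc k)) (c j)) = 0"
      using z0 by (simp add: sum.atMost_Suc_shift del: sum.atMost_Suc)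
    then show "(\<Sum>i<q. z (Suc i) * a ((r \<circ> Suc) i) (c j)) = 0"
      using zq by (simp add: lessThan_Suc_atMost[symmetric])
  qed (use nz that in auto)
  from this[OF l] have "d * ((-1) ^ Suc l * M (Suc l)) - M 0 * ((-1) ^ Suc l * minor a q (r \<circ> insert_index (Suc l)) c)
      + M (Suc q) * ((-1) ^ l * minor a q (r \<circ> Suc \<circ> insert_index l) c) = 0"
    using l by (simp add: z_def y_def y1_def y2_def)
  then have "(-1) ^ l * (d * M (Suc l)) = (-1) ^ l * (M 0 * minor a q (r \<circ> insert_index (Suc l)) c
      + M (Suc q) * minor a q (r \<circ> Suc \<circ> insert_index l) c)"
    by (simp add: algebra_simps)
  then have "d * M (Suc l) = M 0 * minor a q (r \<circ> insert_index (Suc l)) c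
      + M (Suc q) * minor a q (r \<circ> Suc \<circ> insert_index l) c"
    by simp
  then show ?thesis unfolding M0 Mq by (simp add: d_def M_def mult.commute)
qed

text \<open>
  Induction on the spread \<open>r q - r 0\<close>. If the rows leave a gap, insert a row into it; the three-term relation
  expresses the minor through minors of smaller size and through the two minors in which the new row
  replaces the first or the last one, which have smaller spread.
\<close>

lemma minor_pos_of_contiguous_rows:
  assumes smaller: "\<And>r. selection q n r \<Longrightarrow> 0 < minor a q r c"
    and contiguous: "\<And>s. s + Suc q \<le> n \<Longrightarrow> 0 < minor a (Suc q) (\<lambda>i. s + i) c"
    and r: "selection (Suc q) n r"
  shows "0 < minor a (Suc q) r c"
  using r
proof (induction "r q - r 0" arbitrary: r rule: less_induct)
  case less
  note r = selectionD[OF less.prems]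
  show ?case
  proof (cases "\<forall>l<q. r (Suc l) = Suc (r l)")
    case True
    have run: "r i = r 0 + i" if "i \<le> q" for i
      using that True by (induction i) auto
    have "minor a (Suc q) r c = minor a (Suc q) (\<lambda>i. r 0 + i) c"
      by (intro minor_cong run refl) simp
    moreover have "r 0 + q < n" using r(2)[of q] run[of q] by simp
    ultimately show ?thesis using contiguous[of "r 0"] by simp
  next
    case False
    then obtain l where l: "l < q" "r (Suc l) \<noteq> Suc (r l)" by blast
    with r(1)[of l "Suc l"] have gap: "Suc (r l) < r (Suc l)" by simp
    \<comment> \<open>the selection \<open>r\<close> with the row after \<open>r l\<close> inserted at position \<open>Suc l\<close>\<close>
    define r' where "r' i = (if i \<le> l then r i else if i = Suc l then Suc (r l) else r (i - 1))" for i
    have step: "r' i < r' (Suc i)" if "i \<le> q" for i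
    proof -
      consider "i < l" | "i = l" | "i = Suc l" | "Suc l < i" by linarith
      then show ?thesis
      proof cases
        case 1
        then show ?thesis using r(1)[of i "Suc i"] l by (simp add: r'_def)
      next
        case 4
        then show ?thesis using r(1)[of "i - 1" i] that by (simp add: r'_def)
      qed (use gap in \<open>simp_all add: r'_def\<close>)
    qed
    have mono: "r' i < r' j" if "i < j" "j < Suc (Suc q)" for i j
      using that
    proof (induction j)
      case (Suc j)
      then show ?case using step[of j] by (cases "i = j") auto
    qed simp
    have r': "selection (Suc (Suc q)) n r'"
    proof (rule selectionI[OF mono])
      fix i assume "i < Suc (Suc q)"
      then have "r' i \<le> r' (Suc q)" using mono[of i "Suc q"] by (cases "i = Suc q") auto
      also have "r' (Suc q) = r q" using l by (simp add: r'_def)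
      also have "\<dots> < n" by (rule r) simp
      finally show "r' i < n" .
    qed
    note s1 = selection_Suc(1)[OF r'] and s2 = selection_Suc(2)[OF r']
    have r_eq: "r' (insert_index (Suc l) i) = r i" for i
      by (auto simp: r'_def insert_index_def)
    have "minor a (Suc q) r c * minor a q (r' \<circ> Suc) c
      = minor a (Suc q) (r' \<circ> Suc) c * minor a q (r' \<circ> insert_index (Suc l)) c
        + minor a (Suc q) r' c * minor a q (r' \<circ> Suc \<circ> insert_index l) c"
    proof -
      have "0 < minor a q (r' \<circ> Suc) c"
        by (rule smaller[OF selection_Suc(2)[OF s1]])
      then show ?thesis
        using minor_three_term[OF l(1), of a r' c] r_eq by (simp add: o_def)
    qed
    moreover have "0 < minor a q (r' \<circ> Suc) c" "0 < minor a q (r' \<circ> insert_index (Suc l)) c"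
      "0 < minor a q (r' \<circ> Suc \<circ> insert_index l) c"
      by (fact smaller[OF selection_Suc(2)[OF s1]] smaller[OF selection_insert_index[OF s2]]
          smaller[OF selection_insert_index[OF s1]])+
    moreover have "0 < minor a (Suc q) (r' \<circ> Suc) c"
    proof (rule less.hyps)
      have "r' (Suc q) = r q" using l by (simp add: r'_def)
      moreover have "r 0 = r' 0" by (simp add: r'_def)
      moreover have "r' 0 < r' (Suc 0)" "r' (Suc 0) \<le> r' (Suc q)"
        using mono[of 0 "Suc 0"] mono[of "Suc 0" "Suc q"] l by (auto intro: less_imp_le)
      ultimately show "(r' \<circ> Suc) q - (r' \<circ> Suc) 0 < r q - r 0" by simp
    qed (fact s1)
    moreover have "0 < minor a (Suc q) r' c"
    proof (rule less.hyps)
      have "r' (Suc q) = r q" using l by (simp add: r'_def)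
      moreover have "r 0 = r' 0" by (simp add: r'_def)
      moreover have "r' q < r' (Suc q)" "r' 0 < r' q"
        using mono[of q "Suc q"] mono[of 0 q] l by auto
      ultimately show "r' q - r' 0 < r q - r 0" by simp
    qed (fact s2)
    ultimately have "0 < minor a (Suc q) r c * minor a q (r' \<circ> Suc) c"
      by (simp add: add_pos_pos)
    with \<open>0 < minor a q (r' \<circ> Suc) c\<close> show ?thesis by (simp add: zero_less_mult_iff)
  qed
qed

text \<open>
  Fekete's criterion: fill in arbitrary rows first, keeping the columns contiguous, and then arbitrary
  columns, by transposition.
\<close>

theorem fekete:
  assumes contiguous: "\<And>p s t. s + p \<le> n \<Longrightarrow> t + p \<le> n \<Longrightarrow> 0 < minor a p (\<lambda>i. s + i) (\<lambda>j. t + j)"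
    and "selection p n r" "selection p n c"
  shows "0 < minor a p r c"
proof -
  have columns: "0 < minor a p r (\<lambda>j. t + j)" if "selection p n r" "t + p \<le> n" for p r t
    using that
  proof (induction p arbitrary: r)
    case 0
    show ?case by (simp add: minor_0)
  next
    case (Suc p)
    show ?case
    proof (rule minor_pos_of_contiguous_rows[OF _ _ Suc.prems(1)])
      show "0 < minor a p r' (\<lambda>j. t + j)" if "selection p n r'" for r'
        using Suc.IH[OF that] Suc.prems(2) by simp
      show "0 < minor a (Suc p) (\<lambda>i. s + i) (\<lambda>j. t + j)" if "s + Suc p \<le> n" for s
        using contiguous[OF that] Suc.prems(2) by simp
    qed
  qed
  show ?thesis
    using assms(2,3)
  proof (induction p arbitrary: r c)
    case 0
    show ?case by (simp add: minor_0)
  next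
    case (Suc p)
    have "0 < minor (\<lambda>i j. a j i) (Suc p) c r"
    proof (rule minor_pos_of_contiguous_rows[OF _ _ Suc.prems(2)])
      show "0 < minor (\<lambda>i j. a j i) p c' r" if "selection p n c'" for c'
        using Suc.IH[OF selection_Suc(2)[OF Suc.prems(1)] that] by (simp only: minor_transpose[of a])
      show "0 < minor (\<lambda>i j. a j i) (Suc p) (\<lambda>i. s + i) r" if "s + Suc p \<le> n" for s
        using columns[OF Suc.prems(1) that] by (simp only: minor_transpose[of a])
    qed
    then show ?case by (simp only: minor_transpose[of a])
  qed
qed

section \<open>Principal minors and definiteness\<close>

text \<open>
  One step of Gaussian elimination, written as multiplication by a lower triangular matrix with unit
  diagonal.
\<close>

lemma det_schur:
  assumes "b 0 0 \<noteq> 0"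
  shows "Determinant.det (Matrix.mat (Suc p) (Suc p) (\<lambda>(i, j). b i j))
    = b 0 0 * Determinant.det (Matrix.mat p p (\<lambda>(i, j). schur b i j))"
proof -
  let ?n = "Suc p"
  define T where "T = Matrix.mat ?n ?n (\<lambda>(i, j). if j = 0 then b i 0 / b 0 0 else if i = j then 1 else 0)"
  define U where "U = Matrix.mat ?n ?n (\<lambda>(i, j). if i = 0 then b 0 j else if j = 0 then 0 else schur b (i - 1) (j - 1))"
  have carr: "T \<in> carrier_mat ?n ?n" "U \<in> carrier_mat ?n ?n" by (simp_all add: T_def U_def)
  have "Matrix.mat ?n ?n (\<lambda>(i, j). b i j) = T * U"
  proof (intro eq_matI)
    fix i j assume "i < dim_row (T * U)" "j < dim_col (T * U)"
    then have ij: "i < ?n" "j < ?n" by (simp_all add: T_def U_def)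
    have "(T * U) $$ (i, j) = (\<Sum>k<?n. T $$ (i, k) * U $$ (k, j))"
      using ij carr by (simp add: scalar_prod_def atLeast0LessThan T_def U_def del: sum.lessThan_Suc)
    also have "\<dots> = b i 0 / b 0 0 * b 0 j + (\<Sum>k<p. T $$ (i, Suc k) * U $$ (Suc k, j))"
      using ij by (subst sum.lessThan_Suc_shift) (simp add: T_def U_def)
    also have "(\<Sum>k<p. T $$ (i, Suc k) * U $$ (Suc k, j))
        = (\<Sum>k<p. if i = Suc k then (if j = 0 then 0 else schur b k (j - 1)) else 0)"
      using ij by (intro sum.cong) (auto simp: T_def U_def)
    also have "b i 0 / b 0 0 * b 0 j + \<dots> = b i j"
    proof (cases i)
      case 0
      then show ?thesis using assms by simp
    next
      case (Suc i')
      then have "(\<Sum>k<p. if i = Suc k then (if j = 0 then 0 else schur b k (j - 1)) else 0)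
          = (if j = 0 then 0 else schur b i' (j - 1))" using ij by simp
      then show ?thesis using Suc assms by (cases j) (auto simp: schur_def)
    qed
    finally show "Matrix.mat ?n ?n (\<lambda>(i, j). b i j) $$ (i, j) = (T * U) $$ (i, j)"
      using ij by simp
  qed (simp_all add: T_def U_def)
  then have "Determinant.det (Matrix.mat ?n ?n (\<lambda>(i, j). b i j)) = Determinant.det T * Determinant.det U"
    using carr by (simp add: det_mult)
  also have "Determinant.det T = prod_list (diag_mat T)"
    by (rule det_lower_triangular[of ?n]) (auto simp: T_def)
  also have "diag_mat T = replicate ?n 1"
    using assms by (intro nth_equalityI) (auto simp: diag_mat_def T_def simp del: upt_Suc)
  also have "prod_list \<dots> = (1::real)"
    by (simp only: prod_list_replicate power_one)
  also have "Determinant.det U = (\<Sum>k<?n. U $$ (k, 0) * cofactor U k 0)"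
    by (rule laplace_expansion_column[OF carr(2)]) simp
  also have "\<dots> = b 0 0 * cofactor U 0 0"
    by (subst sum.lessThan_Suc_shift) (simp add: U_def)
  also have "mat_delete U 0 0 = Matrix.mat p p (\<lambda>(i, j). schur b i j)"
    by (intro eq_matI) (auto simp: mat_delete_def U_def)
  then have "cofactor U 0 0 = Determinant.det (Matrix.mat p p (\<lambda>(i, j). schur b i j))"
    by (simp add: cofactor_def)
  finally show ?thesis by simp
qed

lemma minor_schur:
  assumes "a 0 0 \<noteq> 0"
  shows "minor a (Suc p) (case_nat 0 (Suc \<circ> r)) (case_nat 0 (Suc \<circ> c)) = a 0 0 * minor (schur a) p r c"
  using det_schur[of "\<lambda>i j. a (case_nat 0 (Suc \<circ> r) i) (case_nat 0 (Suc \<circ> c) j)" p] assms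
  by (simp add: minor_def schur_def)

lemma minor_1: "minor a 1 r c = a (r 0) (c 0)"
  unfolding minor_def by (subst det_single) auto

lemma minor_2: "minor a 2 r c = a (r 0) (c 0) * a (r 1) (c 1) - a (r 1) (c 0) * a (r 0) (c 1)"
proof -
  let ?A = "Matrix.mat 2 2 (\<lambda>(i, j). a (r i) (c j))"
  have "Determinant.det ?A = (\<Sum>k<2. ?A $$ (k, 0) * cofactor ?A k 0)"
    by (rule laplace_expansion_column) auto
  moreover have "Determinant.det (mat_delete ?A 0 0) = a (r 1) (c 1)"
    by (subst det_single) (auto simp: mat_delete_def)
  moreover have "Determinant.det (mat_delete ?A 1 0) = a (r 0) (c 1)"
    by (subst det_single) (auto simp: mat_delete_def)
  ultimately show ?thesis by (simp add: minor_def numeral_2_eq_2 cofactor_def)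
qed

text \<open>
  Principal minors of the Schur complement are, up to the factor \<open>a 0 0\<close>, principal minors of \<open>a\<close>. If
  \<open>a 0 0\<close> vanishes, the principal minors of size two force its row to vanish.
\<close>

lemma psd_of_principal_minors:
  assumes "\<And>i j. i < m \<Longrightarrow> j < m \<Longrightarrow> a i j = a j i"
    and "\<And>p r. selection p m r \<Longrightarrow> 0 \<le> minor a p r r"
  shows "psd m a"
  using assms
proof (induction m arbitrary: a)
  case 0
  show ?case by (simp add: psd_def qform_def)
next
  case (Suc m)
  have "selection 1 (Suc m) (\<lambda>_. 0)" by (intro selectionI) auto
  from Suc.prems(2)[OF this] have a00: "0 \<le> a 0 0" by (simp only: minor_1)
  have "0 \<le> qform (Suc m) a v" for v
  proof (cases "a 0 0 = 0")
    case True
    have z: "a 0 j = 0" if "j \<le> m" for j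
    proof (cases "j = 0")
      case False
      have "selection 2 (Suc m) (case_nat 0 (\<lambda>_. j))"
        using False that by (intro selectionI) (auto simp: less_2_cases_iff split: nat.splits)
      from Suc.prems(2)[OF this] have "a j 0 * a 0 j \<le> 0" using True by (simp add: minor_2)
      moreover have "a j 0 = a 0 j" using Suc.prems(1) that by simp
      ultimately show ?thesis by (auto simp: mult_le_0_iff)
    qed (use True in simp)
    have "psd m (\<lambda>i j. a (Suc i) (Suc j))"
    proof (rule Suc.IH)
      fix p r assume "selection p m r"
      then have "selection p (Suc m) (Suc \<circ> r)" using selectionD by (intro selectionI) fastforce+
      from Suc.prems(2)[OF this] show "0 \<le> minor (\<lambda>i j. a (Suc i) (Suc j)) p r r"
        by (simp add: minor_def)
    qed (simp add: Suc.prems(1))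
    moreover have "a j 0 = 0" if "j \<le> m" for j using z[OF that] Suc.prems(1)[of 0 j] that by simp
    ultimately show ?thesis using z by (subst qform_zero_border) (auto intro: psd_qform)
  next
    case False
    with a00 have pos: "0 < a 0 0" by simp
    have sym: "a 0 (Suc j) = a (Suc j) 0" if "j < m" for j using Suc.prems(1) that by simp
    have "psd m (schur a)"
    proof (rule Suc.IH)
      show "schur a i j = schur a j i" if "i < m" "j < m" for i j
        using that sym[of i] sym[of j] Suc.prems(1)[of "Suc i" "Suc j"] by (simp add: schur_def)
      fix p r assume r: "selection p m r"
      have "selection (Suc p) (Suc m) (case_nat 0 (Suc \<circ> r))"
        using selectionD[OF r] by (intro selectionI) (auto split: nat.splits)
      from Suc.prems(2)[OF this] show "0 \<le> minor (schur a) p r r"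
        using pos by (simp add: minor_schur zero_le_mult_iff)
    qed
    with pos sym show ?thesis by (subst qform_schur) (auto intro: psd_qform add_nonneg_nonneg)
  qed
  then show ?case using Suc.prems(1) by (simp add: psd_def)
qed

definition pd :: "nat \<Rightarrow> (nat \<Rightarrow> nat \<Rightarrow> real) \<Rightarrow> bool" where
  "pd m a \<longleftrightarrow> (\<forall>i<m. \<forall>j<m. a i j = a j i) \<and> (\<forall>v. (\<exists>i<m. v i \<noteq> 0) \<longrightarrow> 0 < qform m a v)"

lemma pd_qform: "pd m a \<Longrightarrow> i < m \<Longrightarrow> v i \<noteq> 0 \<Longrightarrow> 0 < qform m a v"
  by (auto simp: pd_def)

lemma pd_sym: "pd m a \<Longrightarrow> i < m \<Longrightarrow> j < m \<Longrightarrow> a i j = a j i"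
  by (auto simp: pd_def)

lemma pd_shift:
  assumes "pd (Suc m) a"
  shows "pd m (\<lambda>i j. a (Suc i) (Suc j))"
  unfolding pd_def
proof (intro conjI allI impI)
  fix v :: "nat \<Rightarrow> real" assume "\<exists>i<m. v i \<noteq> 0"
  then obtain i where "i < m" "v i \<noteq> 0" by blast
  then show "0 < qform m (\<lambda>i j. a (Suc i) (Suc j)) v"
    using pd_qform[OF assms, of "Suc i" "case_nat 0 v"] by (simp add: qform_Suc)
qed (use pd_sym[OF assms] in auto)

lemma pd_restrict:
  assumes "pd (Suc m) a"
  shows "pd m a"
  unfolding pd_def
proof (intro conjI allI impI)
  fix v :: "nat \<Rightarrow> real" assume "\<exists>i<m. v i \<noteq> 0"
  then obtain i where i: "i < m" "v i \<noteq> 0" by blast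
  then have "0 < qform (Suc m) a (v(m := 0))"
    using pd_qform[OF assms, of i "v(m := 0)"] by simp
  also have "\<dots> = qform m a v" by (simp add: qform_def)
  finally show "0 < qform m a v" .
qed (use pd_sym[OF assms] in auto)

lemma pd_offset: "pd m a \<Longrightarrow> q + p \<le> m \<Longrightarrow> pd p (\<lambda>i j. a (q + i) (q + j))"
proof (induction m arbitrary: a q)
  case 0
  then show ?case by simp
next
  case (Suc m)
  show ?case
  proof (cases q)
    case 0
    show ?thesis
    proof (cases "p = Suc m")
      case False
      then show ?thesis using Suc.IH[OF pd_restrict[OF Suc.prems(1)], of 0] Suc.prems(2) 0 by simp
    qed (use Suc.prems 0 in simp)
  next
    case (Suc q')
    then show ?thesis using Suc.IH[OF pd_shift[OF Suc.prems(1)], of q'] Suc.prems(2) by simp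
  qed
qed

lemma pd_det_pos: "pd p a \<Longrightarrow> 0 < Determinant.det (Matrix.mat p p (\<lambda>(i, j). a i j))"
proof (induction p arbitrary: a)
  case 0
  have "Determinant.det (Matrix.mat 0 0 (\<lambda>(i, j). a i j)) = 1" by (rule det_dim_zero) auto
  then show ?case by simp
next
  case (Suc p)
  have a00: "0 < a 0 0"
    using pd_qform[OF Suc.prems, of 0 "case_nat 1 (\<lambda>_. 0)"] by (simp add: qform_Suc)
  have sym: "a 0 (Suc j) = a (Suc j) 0" if "j < p" for j using pd_sym[OF Suc.prems] that by simp
  have "pd p (schur a)"
    unfolding pd_def
  proof (intro conjI allI impI)
    show "schur a i j = schur a j i" if "i < p" "j < p" for i j
      using that sym[of i] sym[of j] pd_sym[OF Suc.prems, of "Suc i" "Suc j"] by (simp add: schur_def)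
    fix v :: "nat \<Rightarrow> real" assume "\<exists>i<p. v i \<noteq> 0"
    then obtain i where i: "i < p" "v i \<noteq> 0" by blast
    \<comment> \<open>this value of the first variable minimises the form\<close>
    let ?w = "case_nat (- (\<Sum>i<p. v i * a (Suc i) 0) / a 0 0) v"
    have "0 < qform (Suc p) a ?w" using pd_qform[OF Suc.prems, of "Suc i" ?w] i by simp
    then show "0 < qform p (schur a) v"
      using a00 by (subst (asm) qform_schur) (auto simp: sym)
  qed
  then show ?case using Suc.IH a00 by (subst det_schur) auto
qed

section \<open>Totally non-negative Hankel matrices\<close>

lemma selection_inj_on: "selection p n r \<Longrightarrow> inj_on r {..<p}"
  by (auto simp: selection_def intro: strict_mono_on_imp_inj_on)

text \<open>
  A selection is the increasing enumeration of its image; this links \<open>minor\<close> with \<open>submatrix\<close>.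
\<close>

lemma pick_selection:
  assumes "selection p n r" "i < p"
  shows "pick (r ` {..<p}) i = r i"
proof -
  have less: "r x < r i \<longleftrightarrow> x < i" if "x < p" for x
    using selectionD(1)[OF assms(1), of x i] selectionD(1)[OF assms(1), of i x] assms(2) that
    by (cases x i rule: linorder_cases) auto
  have "{x \<in> r ` {..<p}. x < r i} = r ` {..<i}"
    using less assms(2) by auto
  moreover have "inj_on r {..<i}"
    by (rule inj_on_subset[OF selection_inj_on[OF assms(1)]]) (use assms(2) in auto)
  ultimately have "card {x \<in> r ` {..<p}. x < r i} = i" by (simp add: card_image)
  moreover have "r i \<in> r ` {..<p}" using assms(2) by simp
  ultimately show ?thesis using pick_card_in_set[of "r i" "r ` {..<p}"] by simp
qed

lemma submatrix_pick:
  assumes "A \<in> carrier_mat n n" "I \<subseteq> {..<n}" "J \<subseteq> {..<n}" "card I = p" "card J = p"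
  shows "submatrix A I J = Matrix.mat p p (\<lambda>(i, j). A $$ (pick I i, pick J j))"
proof -
  have "{i. i < n \<and> i \<in> I} = I" "{i. i < n \<and> i \<in> J} = J" using assms(2,3) by auto
  then show ?thesis using assms(1,4,5) by (simp add: submatrix_def)
qed

lemma totally_nonneg_iff_minors:
  assumes A: "A \<in> carrier_mat n n" "\<And>i j. i < n \<Longrightarrow> j < n \<Longrightarrow> A $$ (i, j) = a i j"
  shows "totally_nonneg A \<longleftrightarrow>
    (\<forall>p r c. selection p n r \<longrightarrow> selection p n c \<longrightarrow> 0 \<le> minor a p r c)"
proof (intro iffI allI impI)
  fix p r c assume TN: "totally_nonneg A" and r: "selection p n r" and c: "selection p n c"
  have card: "card (r ` {..<p}) = p" "card (c ` {..<p}) = p"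
    using selection_inj_on[OF r] selection_inj_on[OF c] by (simp_all add: card_image)
  have sub: "r ` {..<p} \<subseteq> {..<n}" "c ` {..<p} \<subseteq> {..<n}"
    using selectionD(2)[OF r] selectionD(2)[OF c] by auto
  have "submatrix A (r ` {..<p}) (c ` {..<p}) = Matrix.mat p p (\<lambda>(i, j). a (r i) (c j))"
    unfolding submatrix_pick[OF A(1) sub card]
    using selectionD(2)[OF r] selectionD(2)[OF c]
    by (intro eq_matI) (simp_all add: pick_selection[OF r] pick_selection[OF c] A(2))
  moreover have "0 \<le> Determinant.det (submatrix A (r ` {..<p}) (c ` {..<p}))"
    using TN sub card A(1) unfolding totally_nonneg_def by simp
  ultimately show "0 \<le> minor a p r c" by (simp add: minor_def)
next
  assume minors: "\<forall>p r c. selection p n r \<longrightarrow> selection p n c \<longrightarrow> 0 \<le> minor a p r c"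
  show "totally_nonneg A"
    unfolding totally_nonneg_def
  proof (intro allI impI)
    fix I J assume "I \<subseteq> {..<dim_row A}" "J \<subseteq> {..<dim_col A}" and IJ: "card I = card J"
    then have sub: "I \<subseteq> {..<n}" "J \<subseteq> {..<n}" using A(1) by auto
    have sel: "selection (card K) n (pick K)" if "K \<subseteq> {..<n}" for K
      using pick_mono_le[of _ K] pick_in_set_le[of _ K] that by (intro selectionI) auto
    have "submatrix A I J = Matrix.mat (card I) (card I) (\<lambda>(i, j). a (pick I i) (pick J j))"
      unfolding submatrix_pick[OF A(1) sub refl IJ[symmetric]]
      using selectionD(2)[OF sel[OF sub(1)]] selectionD(2)[OF sel[OF sub(2)]] IJ
      by (intro eq_matI) (simp_all add: A(2))
    moreover have "0 \<le> minor a (card I) (pick I) (pick J)"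
      using minors sel[OF sub(1)] sel[OF sub(2)] IJ by simp
    ultimately show "0 \<le> Determinant.det (submatrix A I J)" by (simp add: minor_def)
  qed
qed

text \<open>
  A contiguous minor that starts at \<open>(k, l)\<close> depends only on \<open>k + l\<close>. It is therefore a principal minor of
  the Hankel matrix if \<open>k + l\<close> is even, and of its shift if \<open>k + l\<close> is odd.
\<close>

lemma hankel_minors_pos:
  assumes even: "pd n (\<lambda>i j. s (i + j))" and odd: "pd (n - 1) (\<lambda>i j. s (Suc (i + j)))"
    and "selection p n r" "selection p n c"
  shows "0 < minor (\<lambda>i j. s (i + j)) p r c"
proof (rule fekete[OF _ assms(3,4)])
  fix p k l assume kl: "k + p \<le> n" "l + p \<le> n"
  show "0 < minor (\<lambda>i j. s (i + j)) p (\<lambda>i. k + i) (\<lambda>j. l + j)"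
  proof (cases "p = 0")
    case False
    show ?thesis
    proof (cases "even (k + l)")
      case True
      then obtain q where q: "k + l = 2 * q" by (elim evenE)
      have "0 < Determinant.det (Matrix.mat p p (\<lambda>(i, j). s (q + i + (q + j))))"
        by (intro pd_det_pos pd_offset[OF even]) (use q kl in simp)
      moreover have "q + i + (q + j) = k + i + (l + j)" for i j using q by simp
      ultimately show ?thesis by (simp only: minor_def)
    next
      case odd': False
      then obtain q where q: "k + l = 2 * q + 1" by (elim oddE)
      have "0 < Determinant.det (Matrix.mat p p (\<lambda>(i, j). s (Suc (q + i + (q + j)))))"
        by (intro pd_det_pos pd_offset[OF odd]) (use q kl in simp)
      moreover have "Suc (q + i + (q + j)) = k + i + (l + j)" for i j using q by simp
      ultimately show ?thesis by (simp only: minor_def)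
    qed
  qed (simp add: minor_0)
qed

text \<open>
  The quadratic form is a weighted sum of squares of values of the polynomial with coefficients \<open>v\<close>, which
  has fewer roots than there are nodes.
\<close>

lemma pd_moments:
  fixes w x :: "nat \<Rightarrow> real"
  assumes w: "\<And>k. k < n \<Longrightarrow> 0 < w k" and x: "inj_on x {..<n}" and "m \<le> n"
  shows "pd m (\<lambda>i j. \<Sum>k<n. w k * x k ^ (i + j))"
  unfolding pd_def
proof (intro conjI allI impI)
  fix v :: "nat \<Rightarrow> real" assume "\<exists>i<m. v i \<noteq> 0"
  then obtain i where i: "i < m" "v i \<noteq> 0" by blast
  define J where "J k = (\<Sum>i<m. v i * x k ^ i)" for k
  have "qform m (\<lambda>i j. \<Sum>k<n. w k * x k ^ (i + j)) v = (\<Sum>k<n. w k * (J k)\<^sup>2)"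
    by (simp only: qform_sum qform_scale power_add qform_rank_one J_def)
  moreover have "\<dots> \<noteq> 0"
  proof
    assume "(\<Sum>k<n. w k * (J k)\<^sup>2) = 0"
    then have "\<forall>k\<in>{..<n}. w k * (J k)\<^sup>2 = 0"
      using w by (subst (asm) sum_nonneg_eq_0_iff) (auto intro!: mult_nonneg_nonneg simp: less_imp_le)
    then have J0: "J k = 0" if "k < n" for k
      using w[OF that] that by (metis lessThan_iff less_irrefl mult_eq_0_iff power_not_zero)
    define Z where "Z = {z. (\<Sum>i\<le>m - 1. v i * z ^ i) = 0}"
    have Z: "finite Z" "card Z \<le> m - 1"
      using Transcendental.polyfun_rootbound[where c = v and k = i and n = "m - 1"] i unfolding Z_def by auto
    have "{..m - 1} = {..<m}" using i by auto
    then have "(\<Sum>i\<le>m - 1. v i * x k ^ i) = 0" if "k < n" for k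
      using J0[OF that] by (simp only: J_def)
    then have "x ` {..<n} \<subseteq> Z" unfolding Z_def by blast
    from card_mono[OF Z(1) this] have "card (x ` {..<n}) \<le> m - 1" using Z(2) by simp
    with x \<open>m \<le> n\<close> i show False by (simp add: card_image)
  qed
  moreover have "0 \<le> (\<Sum>k<n. w k * (J k)\<^sup>2)"
    using w by (intro sum_nonneg mult_nonneg_nonneg) (auto intro: less_imp_le)
  ultimately show "0 < qform m (\<lambda>i j. \<Sum>k<n. w k * x k ^ (i + j)) v" by simp
qed (simp add: add.commute)

lemma pd_add_scaled:
  assumes "psd m a" "pd m b" "0 < e"
  shows "pd m (\<lambda>i j. a i j + e * b i j)"
  unfolding pd_def
proof (intro conjI allI impI)
  fix v :: "nat \<Rightarrow> real" assume "\<exists>i<m. v i \<noteq> 0"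
  then have "0 < qform m b v" using assms(2) by (auto simp: pd_def)
  then show "0 < qform m (\<lambda>i j. a i j + e * b i j) v"
    using psd_qform[OF assms(1), of v] assms(3) by (simp add: qform_add qform_scale add_nonneg_pos)
qed (use psd_sym[OF assms(1)] pd_sym[OF assms(2)] in auto)

lemma continuous_on_minor_perturbation:
  "continuous_on UNIV (\<lambda>e. minor (\<lambda>i j. a i j + e * b i j) p r c)"
proof -
  have "minor (\<lambda>i j. a i j + e * b i j) p r c = (\<Sum>q | q permutes {0..<p}.
      signof q * (\<Prod>i = 0..<p. a (r i) (c (q i)) + e * b (r i) (c (q i))))" for e
  proof -
    have "minor (\<lambda>i j. a i j + e * b i j) p r c = (\<Sum>q | q permutes {0..<p}. signof q *
      (\<Prod>i = 0..<p. Matrix.mat p p (\<lambda>(i, j). a (r i) (c j) + e * b (r i) (c j)) $$ (i, q i)))"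
      unfolding minor_def by (rule det_def') simp
    also have "\<dots> = (\<Sum>q | q permutes {0..<p}.
      signof q * (\<Prod>i = 0..<p. a (r i) (c (q i)) + e * b (r i) (c (q i))))"
    proof (intro sum.cong prod.cong arg_cong2[where f = "(*)"] refl)
      fix q i assume "q \<in> {q. q permutes {0..<p}}" "i \<in> {0..<p}"
      then have "i < p" "q i < p" using permutes_in_image[of q "{0..<p}" i] by auto
      then show "Matrix.mat p p (\<lambda>(i, j). a (r i) (c j) + e * b (r i) (c j)) $$ (i, q i)
          = a (r i) (c (q i)) + e * b (r i) (c (q i))" by simp
    qed
    finally show ?thesis .
  qed
  then show ?thesis by (simp only:) (intro continuous_intros)
qed

text \<open>
  Add a small multiple of the moment sequence of the nodes \<open>1, \<dots>, n\<close>, for which both matrices are positive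
  definite, and let it tend to zero.
\<close>

lemma hankel_minors_nonneg:
  assumes even: "psd n (\<lambda>i j. s (i + j))" and odd: "psd (n - 1) (\<lambda>i j. s (Suc (i + j)))"
    and r: "selection p n r" and c: "selection p n c"
  shows "0 \<le> minor (\<lambda>i j. s (i + j)) p r c"
proof -
  \<comment> \<open>The nodes are positive, since they become the weights of the shifted moments.\<close>
  define x where "x k = real (Suc k)" for k
  define g where "g t = (\<Sum>k<n. x k ^ t)" for t
  have inj: "inj_on x {..<n}" by (auto simp: x_def inj_on_def)
  have g_even: "pd n (\<lambda>i j. g (i + j))"
    using pd_moments[of n "\<lambda>_. 1" x n] inj by (simp add: g_def)
  have g_odd: "pd (n - 1) (\<lambda>i j. g (Suc (i + j)))"
    using pd_moments[of n x x "n - 1"] inj by (simp add: g_def x_def)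
  define F where "F e = minor (\<lambda>i j. s (i + j) + e * g (i + j)) p r c" for e
  have "continuous_on UNIV F" unfolding F_def by (rule continuous_on_minor_perturbation)
  then have "(F \<longlongrightarrow> F 0) (at_right 0)"
    by (simp add: continuous_on_eq_continuous_at continuous_at_imp_continuous_at_within
        flip: continuous_within)
  moreover have "0 \<le> F e" if "0 < e" for e
  proof -
    have "0 < minor (\<lambda>i j. (\<lambda>t. s t + e * g t) (i + j)) p r c"
      using pd_add_scaled[OF even g_even that] pd_add_scaled[OF odd g_odd that]
      by (intro hankel_minors_pos[where n = n] r c) auto
    then show ?thesis by (simp add: F_def)
  qed
  then have "\<forall>\<^sub>F e in at_right 0. 0 \<le> F e"
    by (auto simp: eventually_at_filter)
  ultimately have "0 \<le> F 0" by (rule tendsto_lowerbound) simp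
  then show ?thesis by (simp add: F_def)
qed

text \<open>
  The principal minors of the shifted matrix are minors of the Hankel matrix itself, with the columns
  moved by one.
\<close>

lemma HTN_psd:
  assumes "A \<in> HTN n {0<..}"
  obtains s where "\<And>i j. i < n \<Longrightarrow> j < n \<Longrightarrow> A $$ (i, j) = s (i + j)"
    "psd n (\<lambda>i j. s (i + j))" "psd (n - 1) (\<lambda>i j. s (Suc (i + j)))"
    "\<And>i j. i < n \<Longrightarrow> j < n \<Longrightarrow> 0 < s (i + j)"
proof -
  have A: "A \<in> carrier_mat n n" "totally_nonneg A" "elements_mat A \<subseteq> {0<..}"
    using assms by (auto simp: HTN_def)
  obtain s where s: "\<And>i j. i < n \<Longrightarrow> j < n \<Longrightarrow> A $$ (i, j) = s (i + j)"
    using assms by (auto simp: HTN_def hankel_def)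
  have minors: "0 \<le> minor (\<lambda>i j. s (i + j)) p r c" if "selection p n r" "selection p n c" for p r c
    using A(2) that totally_nonneg_iff_minors[where a = "\<lambda>i j. s (i + j)", OF A(1) s] by blast
  have "psd n (\<lambda>i j. s (i + j))"
    by (rule psd_of_principal_minors) (auto simp: add.commute intro: minors)
  moreover have "psd (n - 1) (\<lambda>i j. s (Suc (i + j)))"
  proof (rule psd_of_principal_minors)
    fix p r assume r: "selection p (n - 1) r"
    have "selection p n r" "selection p n (Suc \<circ> r)"
      using selectionD(1)[OF r] selectionD(2)[OF r] by (fastforce intro!: selectionI)+
    from minors[OF this] show "0 \<le> minor (\<lambda>i j. s (Suc (i + j))) p r r"
      by (simp add: minor_def)
  qed (simp add: add.commute)
  moreover have "0 < s (i + j)" if "i < n" "j < n" for i j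
  proof -
    have "A $$ (i, j) \<in> elements_mat A" using that A(1) by auto
    with A(3) s[OF that] show ?thesis by auto
  qed
  ultimately show ?thesis using that s by blast
qed

lemma entrywise_preserves_HTN:
  assumes "\<And>m a v. m \<le> n \<Longrightarrow> psd m a \<Longrightarrow> (\<And>i j. i < m \<Longrightarrow> j < m \<Longrightarrow> 0 < a i j) \<Longrightarrow>
             0 \<le> qform m (\<lambda>i j. f (a i j)) v"
  shows "entrywise_preserves_TN_on f (HTN n {0<..})"
  unfolding entrywise_preserves_TN_on_def
proof
  fix A assume A: "A \<in> HTN n {0<..}"
  then obtain s where s: "\<And>i j. i < n \<Longrightarrow> j < n \<Longrightarrow> A $$ (i, j) = s (i + j)"
    "psd n (\<lambda>i j. s (i + j))" "psd (n - 1) (\<lambda>i j. s (Suc (i + j)))"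
    "\<And>i j. i < n \<Longrightarrow> j < n \<Longrightarrow> 0 < s (i + j)"
    by (rule HTN_psd) blast
  have carr: "A \<in> carrier_mat n n" using A by (simp add: HTN_def)
  have even: "psd n (\<lambda>i j. f (s (i + j)))"
    using assms[OF order_refl s(2) s(4)] by (auto simp: psd_def add.commute)
  have "0 < s (Suc (i + j))" if "i < n - 1" "j < n - 1" for i j
    using s(4)[of "Suc i" j] that by simp
  then have odd: "psd (n - 1) (\<lambda>i j. f (s (Suc (i + j))))"
    using assms[OF _ s(3)] by (auto simp: psd_def add.commute)
  have "map_mat f A \<in> carrier_mat n n" using carr by simp
  moreover have "map_mat f A $$ (i, j) = f (s (i + j))" if "i < n" "j < n" for i j
    using that carr s(1) by simp
  ultimately show "totally_nonneg (map_mat f A)"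
    using hankel_minors_nonneg[OF even odd]
    by (subst totally_nonneg_iff_minors[where n = n and a = "\<lambda>i j. f (s (i + j))"]) auto
qed

section \<open>Power series with prescribed signs\<close>

lemma summable_of_fact_bound:
  fixes a :: "nat \<Rightarrow> real"
  assumes "\<And>M. M > m \<Longrightarrow> \<bar>a M\<bar> \<le> 1 / fact M"
  shows "summable (\<lambda>M. a M * x ^ M)"
proof (rule summable_comparison_test_ev)
  show "\<forall>\<^sub>F M in sequentially. norm (a M * x ^ M) \<le> inverse (fact M) * \<bar>x\<bar> ^ M"
    using eventually_gt_at_top[of m]
  proof eventually_elim
    case (elim M)
    have "norm (a M * x ^ M) = \<bar>a M\<bar> * \<bar>x\<bar> ^ M" by (simp add: abs_mult power_abs)
    also have "\<dots> \<le> inverse (fact M) * \<bar>x\<bar> ^ M"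
      using assms[OF elim] by (intro mult_right_mono) (simp_all add: inverse_eq_divide)
    finally show ?case .
  qed
  show "summable (\<lambda>M. inverse (fact M) * \<bar>x\<bar> ^ M)" by (rule summable_exp)
qed

lemma qform_power_series:
  assumes "\<And>i j. i < m \<Longrightarrow> j < m \<Longrightarrow> (\<lambda>M. a M * y i j ^ M) sums f (y i j)"
  shows "(\<lambda>M. a M * qform m (\<lambda>i j. y i j ^ M) v) sums qform m (\<lambda>i j. f (y i j)) v"
proof -
  have "(\<lambda>M. \<Sum>i<m. \<Sum>j<m. v i * v j * (a M * y i j ^ M)) sums qform m (\<lambda>i j. f (y i j)) v"
    unfolding qform_def using assms by (intro sums_sum sums_mult) auto
  then show ?thesis
    by (simp add: qform_def sum_distrib_left mult_ac)
qed

text \<open>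
  The geometric weights add up to \<open>1\<close>, so the negative terms together do not exceed the positive sum.
\<close>

lemma perturbed_series_nonneg:
  fixes b d Q :: "nat \<Rightarrow> real"
  assumes sums: "(\<lambda>M. (b M - d M) * Q M) sums f" and b: "(\<lambda>M. b M * Q M) sums F"
    and small: "\<And>M. d M * Q M \<le> (1/2) ^ Suc M * F"
  shows "0 \<le> f"
proof -
  have "(\<lambda>M. (1/2) ^ Suc M * F) sums (1 * F)"
    by (intro sums_mult2 power_half_series)
  with b have "(\<lambda>M. b M * Q M - (1/2) ^ Suc M * F) sums (F - 1 * F)"
    by (rule sums_diff)
  moreover have "b M * Q M - (1/2) ^ Suc M * F \<le> (b M - d M) * Q M" for M
    using small[of M] by (simp add: algebra_simps)
  ultimately show ?thesis using sums_le[OF _ _ sums] by fastforce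
qed

theorem theorem9p9:
  fixes N :: nat
    and n :: "nat \<Rightarrow> nat"
    and \<epsilon> :: "nat \<Rightarrow> int"
    and c :: "nat \<Rightarrow> real"
  assumes "N > 0"
    and "strict_mono_on {..<N} n"
    and "\<And>M. M > n (N - 1) \<Longrightarrow> \<epsilon> M \<in> {-1, 0, 1}"
    and "\<And>M0. M0 > n (N - 1) \<Longrightarrow> \<epsilon> M0 = -1 \<Longrightarrow>
           \<exists>S. finite S \<and> card S = N \<and> S \<subseteq> {M. M > M0 \<and> \<epsilon> M = 1}"
    and "\<And>j. j < N \<Longrightarrow> c (n j) > 0"
  shows "\<exists>(a :: nat \<Rightarrow> real) (f :: real \<Rightarrow> real).
           (\<forall>x\<in>{0<..}. (\<lambda>M. a M * x ^ M) sums f x) \<and>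
           (\<forall>j<N. a (n j) = c (n j)) \<and>
           (\<forall>M\<le>n (N - 1). M \<notin> n ` {..<N} \<longrightarrow> a M = 0) \<and>
           entrywise_preserves_TN_on f (HTN N {0<..}) \<and>
           (\<forall>M>n (N - 1). sgn (a M) = of_int (\<epsilon> M))"
proof -
  let ?L = "n ` {..<N}" and ?m = "n (N - 1)"
  have n_le: "n j \<le> ?m" if "j < N" for j
  proof (cases "j = N - 1")
    case False
    with that have "j < N - 1" by simp
    then show ?thesis using strict_mono_onD[OF assms(2), of j "N - 1"] that by simp
  qed simp
  have card_L: "card ?L = N"
    using strict_mono_on_imp_inj_on[OF assms(2)] by (simp add: card_image)
  define neg where "neg M \<longleftrightarrow> M > ?m \<and> \<epsilon> M = -1" for M
  define b where "b M = (if M \<in> ?L then c M else if M > ?m \<and> \<epsilon> M = 1 then 1 / fact M else 0)" for M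
  have b_nonneg: "0 \<le> b M" for M
    using assms(5) by (auto simp: b_def less_imp_le)
  define dom where "dom M S K \<longleftrightarrow> finite S \<and> card S = N \<and> S \<subseteq> {M'. M' > M \<and> \<epsilon> M' = 1} \<and> 0 \<le> K \<and>
      (\<forall>m\<le>N. \<forall>a v. psd m a \<longrightarrow> (\<forall>i<m. \<forall>j<m. 0 < a i j) \<longrightarrow>
        qform m (\<lambda>i j. a i j ^ M) v \<le> K * (\<Sum>t\<in>?L \<union> S. qform m (\<lambda>i j. a i j ^ t) v))" for M S K
  have "\<exists>S K. dom M S K" if "neg M" for M
  proof -
    have M: "M > ?m" "\<epsilon> M = -1" using that by (auto simp: neg_def)
    obtain S where S: "finite S" "card S = N" "S \<subseteq> {M'. M' > M \<and> \<epsilon> M' = 1}"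
      using assms(4)[OF M] by blast
    have "l < M" if "l \<in> ?L" for l using that n_le M(1) by fastforce
    moreover have "M < t" if "t \<in> S" for t using that S(3) by blast
    ultimately have "\<exists>K\<ge>0. \<forall>m\<le>N. \<forall>a v. psd m a \<longrightarrow> (\<forall>i<m. \<forall>j<m. 0 < a i j) \<longrightarrow>
        qform m (\<lambda>i j. a i j ^ M) v \<le> K * (\<Sum>t\<in>?L \<union> S. qform m (\<lambda>i j. a i j ^ t) v)"
      using card_L S(1,2) by (intro psd_power_domination) auto
    then show ?thesis using S unfolding dom_def by blast
  qed
  then obtain S K where SK: "\<And>M. neg M \<Longrightarrow> dom M (S M) (K M)" by metis
  define T where "T M = ?L \<union> S M" for M
  have T: "finite (T M)" "T M \<noteq> {}" "\<And>t. t \<in> T M \<Longrightarrow> 0 < b t" if "neg M" for M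
  proof -
    show "finite (T M)" "T M \<noteq> {}"
      using SK[OF that] assms(1) by (auto simp: T_def dom_def)
    fix t assume "t \<in> T M"
    then consider "t \<in> ?L" | "t \<notin> ?L" "t \<in> S M" by (auto simp: T_def)
    then show "0 < b t"
    proof cases
      case 2
      have "t > M" "\<epsilon> t = 1" using SK[OF that] 2(2) by (auto simp: dom_def)
      then show ?thesis using 2(1) that by (simp add: b_def neg_def)
    qed (use assms(5) in \<open>auto simp: b_def\<close>)
  qed
  \<comment> \<open>Every power that dominates \<open>x ^ M\<close> has a coefficient of at least \<open>\<beta> M\<close>.\<close>
  define \<beta> where "\<beta> M = Min (b ` T M)" for M
  \<comment> \<open>The first bound makes the series converge everywhere, the second one makes the term at \<open>M\<close> at most \<open>(1/2) ^ Suc M\<close> times the positive part.\<close>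
  define d where "d M = (if neg M then min (1 / fact M) ((1/2) ^ Suc M * \<beta> M / (K M + 1)) else 0)" for M
  have \<beta>: "0 < \<beta> M" "\<And>t. t \<in> T M \<Longrightarrow> \<beta> M \<le> b t" if "neg M" for M
    using T[OF that] by (auto simp: \<beta>_def)
  have K0: "0 \<le> K M" if "neg M" for M using SK[OF that] by (simp add: dom_def)
  have d_pos: "0 < d M" if "neg M" for M
    using that \<beta>(1)[OF that] K0[OF that] by (simp add: d_def)
  have d_le: "d M \<le> 1 / fact M" for M by (simp add: d_def)
  have d_nonneg: "0 \<le> d M" for M using d_pos[of M] by (cases "neg M") (auto simp: d_def)
  define a where "a M = b M - d M" for M
  define f where "f x = (\<Sum>M. a M * x ^ M)" for x
  have b_large: "b M = (if \<epsilon> M = 1 then 1 / fact M else 0)" if "M > ?m" for M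
    using that n_le by (fastforce simp: b_def)
  have b_small: "\<bar>b M\<bar> \<le> 1 / fact M" if "M > ?m" for M
    using b_large[OF that] by simp
  have a_small: "\<bar>a M\<bar> \<le> 1 / fact M" if "M > ?m" for M
  proof (cases "neg M")
    case True
    then have "b M = 0" using b_large[OF that] by (simp add: neg_def)
    then show ?thesis using d_le d_nonneg by (simp add: a_def)
  next
    case False
    then show ?thesis using b_small[OF that] by (simp add: a_def d_def)
  qed
  have f_sums: "(\<lambda>M. a M * x ^ M) sums f x" for x
    unfolding f_def by (intro summable_sums summable_of_fact_bound[of ?m] a_small)
  have preserves: "0 \<le> qform m (\<lambda>i j. f (y i j)) v"
    if m: "m \<le> N" and y: "psd m y" "\<And>i j. i < m \<Longrightarrow> j < m \<Longrightarrow> 0 < y i j" for m y v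
  proof -
    define Q where "Q t = qform m (\<lambda>i j. y i j ^ t) v" for t
    define F where "F = qform m (\<lambda>i j. \<Sum>M. b M * y i j ^ M) v"
    have Q: "0 \<le> Q t" for t unfolding Q_def by (intro psd_qform psd_power y)
    have F: "(\<lambda>M. b M * Q M) sums F"
      unfolding Q_def F_def
      by (rule qform_power_series)
         (intro summable_sums summable_of_fact_bound[of ?m] b_small)
    have F_ge: "(\<Sum>t\<in>T M. b t * Q t) \<le> F" if "neg M" for M
      using T(1)[OF that] b_nonneg Q F
      by (auto simp: sums_iff intro!: sum_le_suminf mult_nonneg_nonneg)
    have "0 \<le> F" using sums_le[OF _ sums_zero F] b_nonneg Q by simp
    have "d M * Q M \<le> (1/2) ^ Suc M * F" for M
    proof (cases "neg M")
      case True
      note neg = True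
      let ?w = "(1/2) ^ Suc M * \<beta> M / (K M + 1)"
      have "d M * Q M \<le> ?w * (K M * (\<Sum>t\<in>T M. Q t))"
      proof (intro mult_mono)
        show "Q M \<le> K M * (\<Sum>t\<in>T M. Q t)"
          using SK[OF neg] m y unfolding dom_def T_def Q_def by blast
        show "0 \<le> ?w" using \<beta>(1)[OF neg] K0[OF neg] by simp
      qed (use neg Q in \<open>auto simp: d_def\<close>)
      also have "\<dots> = ((1/2) ^ Suc M * (\<Sum>t\<in>T M. \<beta> M * Q t)) * (K M / (K M + 1))"
        by (simp add: sum_distrib_left[symmetric])
      also have "\<dots> \<le> ((1/2) ^ Suc M * (\<Sum>t\<in>T M. \<beta> M * Q t)) * 1"
        using K0[OF neg] \<beta>(1)[OF neg] Q
        by (intro mult_left_mono mult_nonneg_nonneg sum_nonneg) (auto simp: less_imp_le)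
      also have "\<dots> \<le> (1/2) ^ Suc M * (\<Sum>t\<in>T M. b t * Q t)"
        using \<beta>(2)[OF neg] Q by (simp only: mult_1_right) (intro mult_left_mono sum_mono mult_right_mono, auto)
      also have "\<dots> \<le> (1/2) ^ Suc M * F"
        using F_ge[OF neg] by (intro mult_left_mono) auto
      finally show ?thesis .
    qed (use \<open>0 \<le> F\<close> in \<open>simp add: d_def\<close>)
    moreover have "(\<lambda>M. (b M - d M) * Q M) sums qform m (\<lambda>i j. f (y i j)) v"
      unfolding Q_def a_def[symmetric] by (intro qform_power_series f_sums)
    ultimately show ?thesis using perturbed_series_nonneg F by blast
  qed
  show ?thesis
  proof (intro exI[of _ a] exI[of _ f] conjI allI ballI impI)
    show "a (n j) = c (n j)" if "j < N" for j
      using that n_le[OF that] by (simp add: a_def b_def d_def neg_def)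
    show "a M = 0" if "M \<le> ?m" "M \<notin> ?L" for M
      using that by (simp add: a_def b_def d_def neg_def)
    show "entrywise_preserves_TN_on f (HTN N {0<..})"
      by (rule entrywise_preserves_HTN) (rule preserves)
    fix M assume M: "M > ?m"
    then consider "\<epsilon> M = 1" | "\<epsilon> M = 0" | "\<epsilon> M = -1" using assms(3) by blast
    then show "sgn (a M) = of_int (\<epsilon> M)"
    proof cases
      case 3
      then have "neg M" using M by (simp add: neg_def)
      from d_pos[OF this] show ?thesis using 3 b_large[OF M] by (simp add: a_def)
    qed (use b_large[OF M] in \<open>simp_all add: a_def d_def neg_def\<close>)
  qed (rule f_sums)
qed

end
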